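(* For a convex function $f:\mathbb{R}\to\mathbb{R}$ and vectors $a\in\mathbb{R}^n_{>0}$, $b\in\mathbb{R}^n$, both $(a,b,f)$-S/Box/C and $(a,b,f)$-S/Box/I can be solved in $O(n)$ time.
   Context: Let $\mathcal{N}=\{1,\ldots,n\}$, $R\in\mathbb{R}$, and let bounds $l_i\le u_i$ be given for $i\in\mathcal{N}$. The problem $(a,b,f)$-S/Box/$\gamma$ is $$\min_x\ \sum_{i\in\mathcal{N}}a_if\left(\frac{x_i}{a_i}+b_i\right)\quad\text{s.t.}\quad\sum_{i\in\mathcal{N}}x_i=R,\qquad l_i\le x_i\le u_i\ (i\in\mathcal{N}),$$ with $x\in\mathbb{R}^n$ if $\gamma=\text{C}$ and $x\in\mathbb{Z}^n$ if $\gamma=\text{I}$. Solving the problem means computing an optimal solution. *)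

theory Defs
  imports "HOL-Analysis.Analysis" "HOL-Library.Landau_Symbols"
begin

section \<open>The resource allocation problem\<close>

datatype variant = Cont | Intg

definition objective ::
  "nat \<Rightarrow> (nat \<Rightarrow> real) \<Rightarrow> (nat \<Rightarrow> real) \<Rightarrow> (real \<Rightarrow> real) \<Rightarrow> (nat \<Rightarrow> real) \<Rightarrow> real" where
  "objective n a b f x = (\<Sum>i=1..n. a i * f (x i / a i + b i))"

definition feasible ::
  "variant \<Rightarrow> nat \<Rightarrow> real \<Rightarrow> (nat \<Rightarrow> real) \<Rightarrow> (nat \<Rightarrow> real) \<Rightarrow> (nat \<Rightarrow> real) \<Rightarrow> bool" where
  "feasible \<gamma> n R l u x \<longleftrightarrow>
     (\<Sum>i=1..n. x i) = R \<and>
     (\<forall>i\<in>{1..n}. l i \<le> x i \<and> x i \<le> u i) \<and>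
     (\<gamma> = Intg \<longrightarrow> (\<forall>i\<in>{1..n}. x i \<in> \<int>))"

definition optimal ::
  "variant \<Rightarrow> nat \<Rightarrow> (nat \<Rightarrow> real) \<Rightarrow> (nat \<Rightarrow> real) \<Rightarrow> (real \<Rightarrow> real) \<Rightarrow>
   real \<Rightarrow> (nat \<Rightarrow> real) \<Rightarrow> (nat \<Rightarrow> real) \<Rightarrow> (nat \<Rightarrow> real) \<Rightarrow> bool" where
  "optimal \<gamma> n a b f R l u x \<longleftrightarrow>
     feasible \<gamma> n R l u x \<and>
     (\<forall>y. feasible \<gamma> n R l u y \<longrightarrow> objective n a b f x \<le> objective n a b f y)"


section \<open>Unit-cost computation over the reals\<close>

text \<open>
  Running time is measured in a first-order call-by-value language on real numbers and
  cons cells. Values are immutable, so a cell is passed by reference, and a program has finitely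
  many expressions, so environments have bounded size: every evaluation step costs a constant
  number of operations on a real RAM, and a time bound here is one for a real RAM up to a
  constant factor. Only integer constants may occur in a program.

  The function \<open>f\<close> is available as an oracle with unit cost (\<open>Oracle\<close>). Rounding (\<open>Floor\<close>) is
  not an operation of the basic real RAM and can be switched off; it then has no evaluation
  rule. Division by zero and ill-typed operations have no result.
\<close>

datatype val = VNum real | VNil | VCons val val

datatype binop = Plus | Minus | Times | Divide

datatype exp =
    Var nat                      \<comment> \<open>de Bruijn index into the environment\<close>
  | Const int
  | Bin binop exp exp
  | Floor exp
  | Oracle exp
  | Empty
  | Pack exp exp
  | Head exp
  | Tail exp
  | IfLe exp exp exp exp         \<comment> \<open>if first \<open>\<le>\<close> second then third else fourth\<close>
  | IfEmpty exp exp exp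
  | Bind exp exp                 \<comment> \<open>the value becomes variable 0 of the second expression\<close>
  | Call nat "exp list"

text \<open>The list of function bodies; the arguments of a call form the environment of the body.\<close>

type_synonym program = "exp list"

fun binop_defined :: "binop \<Rightarrow> real \<Rightarrow> real \<Rightarrow> bool" where
  "binop_defined Divide x y \<longleftrightarrow> y \<noteq> 0"
| "binop_defined _ x y \<longleftrightarrow> True"

fun binop_value :: "binop \<Rightarrow> real \<Rightarrow> real \<Rightarrow> real" where
  "binop_value Plus x y = x + y"
| "binop_value Minus x y = x - y"
| "binop_value Times x y = x * y"
| "binop_value Divide x y = x / y"

text \<open>
  \<open>eval rnd f P env e t v\<close>: with rounding available iff \<open>rnd\<close>, expression \<open>e\<close> evaluates to \<open>v\<close>
  in exactly \<open>t\<close> steps, one for each node of the evaluation tree.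
\<close>

inductive
  eval :: "bool \<Rightarrow> (real \<Rightarrow> real) \<Rightarrow> program \<Rightarrow> val list \<Rightarrow> exp \<Rightarrow> nat \<Rightarrow> val \<Rightarrow> bool" and
  evals :: "bool \<Rightarrow> (real \<Rightarrow> real) \<Rightarrow> program \<Rightarrow> val list \<Rightarrow> exp list \<Rightarrow> nat \<Rightarrow> val list \<Rightarrow> bool"
  for rnd :: bool and f :: "real \<Rightarrow> real" and P :: program
where
  eval_Var: "i < length env \<Longrightarrow> eval rnd f P env (Var i) 1 (env ! i)"
| eval_Const: "eval rnd f P env (Const c) 1 (VNum (of_int c))"
| eval_Bin:
    "\<lbrakk>eval rnd f P env e1 t1 (VNum x); eval rnd f P env e2 t2 (VNum y); binop_defined bop x y\<rbrakk>
     \<Longrightarrow> eval rnd f P env (Bin bop e1 e2) (1 + t1 + t2) (VNum (binop_value bop x y))"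
| eval_Floor:
    "\<lbrakk>rnd; eval rnd f P env e t (VNum x)\<rbrakk>
     \<Longrightarrow> eval rnd f P env (Floor e) (1 + t) (VNum (of_int \<lfloor>x\<rfloor>))"
| eval_Oracle:
    "eval rnd f P env e t (VNum x) \<Longrightarrow> eval rnd f P env (Oracle e) (1 + t) (VNum (f x))"
| eval_Empty: "eval rnd f P env Empty 1 VNil"
| eval_Pack:
    "\<lbrakk>eval rnd f P env e1 t1 v; eval rnd f P env e2 t2 w\<rbrakk>
     \<Longrightarrow> eval rnd f P env (Pack e1 e2) (1 + t1 + t2) (VCons v w)"
| eval_Head: "eval rnd f P env e t (VCons v w) \<Longrightarrow> eval rnd f P env (Head e) (1 + t) v"
| eval_Tail: "eval rnd f P env e t (VCons v w) \<Longrightarrow> eval rnd f P env (Tail e) (1 + t) w"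
| eval_IfLe_True:
    "\<lbrakk>eval rnd f P env e1 t1 (VNum x); eval rnd f P env e2 t2 (VNum y); x \<le> y;
      eval rnd f P env e3 t3 v\<rbrakk>
     \<Longrightarrow> eval rnd f P env (IfLe e1 e2 e3 e4) (1 + t1 + t2 + t3) v"
| eval_IfLe_False:
    "\<lbrakk>eval rnd f P env e1 t1 (VNum x); eval rnd f P env e2 t2 (VNum y); \<not> x \<le> y;
      eval rnd f P env e4 t4 v\<rbrakk>
     \<Longrightarrow> eval rnd f P env (IfLe e1 e2 e3 e4) (1 + t1 + t2 + t4) v"
| eval_IfEmpty_True:
    "\<lbrakk>eval rnd f P env e1 t1 VNil; eval rnd f P env e2 t2 v\<rbrakk>
     \<Longrightarrow> eval rnd f P env (IfEmpty e1 e2 e3) (1 + t1 + t2) v"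
| eval_IfEmpty_False:
    "\<lbrakk>eval rnd f P env e1 t1 (VCons w w'); eval rnd f P env e3 t3 v\<rbrakk>
     \<Longrightarrow> eval rnd f P env (IfEmpty e1 e2 e3) (1 + t1 + t3) v"
| eval_Bind:
    "\<lbrakk>eval rnd f P env e1 t1 w; eval rnd f P (w # env) e2 t2 v\<rbrakk>
     \<Longrightarrow> eval rnd f P env (Bind e1 e2) (1 + t1 + t2) v"
| eval_Call:
    "\<lbrakk>evals rnd f P env es t1 vs; g < length P; eval rnd f P vs (P ! g) t2 v\<rbrakk>
     \<Longrightarrow> eval rnd f P env (Call g es) (1 + t1 + t2) v"
| evals_Nil: "evals rnd f P env [] 0 []"
| evals_Cons:
    "\<lbrakk>eval rnd f P env e t1 v; evals rnd f P env es t2 vs\<rbrakk>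
     \<Longrightarrow> evals rnd f P env (e # es) (t1 + t2) (v # vs)"

inductive_cases eval_cases:
  "eval rnd f P env (Var i) t v"
  "eval rnd f P env (Const c) t v"
  "eval rnd f P env (Bin bop e1 e2) t v"
  "eval rnd f P env (Floor e) t v"
  "eval rnd f P env (Oracle e) t v"
  "eval rnd f P env Empty t v"
  "eval rnd f P env (Pack e1 e2) t v"
  "eval rnd f P env (Head e) t v"
  "eval rnd f P env (Tail e) t v"
  "eval rnd f P env (IfLe e1 e2 e3 e4) t v"
  "eval rnd f P env (IfEmpty e1 e2 e3) t v"
  "eval rnd f P env (Bind e1 e2) t v"
  "eval rnd f P env (Call g es) t v"
  "evals rnd f P env [] t vs"
  "evals rnd f P env (e # es) t vs"

text \<open>Evaluation is deterministic, so the result and running time of a program are unique.\<close>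

lemma eval_iff:
  "eval rnd f P env e t v \<Longrightarrow> \<forall>t' v'. eval rnd f P env e t' v' \<longleftrightarrow> t' = t \<and> v' = v"
  "evals rnd f P env es t vs \<Longrightarrow> \<forall>t' vs'. evals rnd f P env es t' vs' \<longleftrightarrow> t' = t \<and> vs' = vs"
  apply (induction rule: eval_evals.inducts)
  apply ((intro allI iffI, (erule eval_cases; simp),
          (elim conjE, hypsubst, rule eval_evals.intros; assumption))+)
  done

lemma eval_deterministic:
  "eval rnd f P env e t v \<Longrightarrow> eval rnd f P env e t' v' \<Longrightarrow> t' = t \<and> v' = v"
  by (simp add: eval_iff)

fun encode :: "real list \<Rightarrow> val" where
  "encode [] = VNil"
| "encode (x # xs) = VCons (VNum x) (encode xs)"

definition vec :: "nat \<Rightarrow> (nat \<Rightarrow> real) \<Rightarrow> val" where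
  "vec n x = encode (map x [1..<Suc n])"

text \<open>
  One program and one time bound serve all \<open>f\<close>, \<open>n\<close>, \<open>a\<close>, \<open>b\<close>, \<open>R\<close>, \<open>l\<close>, \<open>u\<close>; nothing is required
  of infeasible instances. Function 0 is the main function. Rounding is available in the
  integer case only.
\<close>

definition solves_within :: "program \<Rightarrow> variant \<Rightarrow> (nat \<Rightarrow> real) \<Rightarrow> bool" where
  "solves_within P \<gamma> T \<longleftrightarrow>
     P \<noteq> [] \<and>
     (\<forall>f n a b R l u.
        convex_on UNIV f \<longrightarrow>
        (\<forall>i\<in>{1..n}. 0 < a i) \<longrightarrow>
        (\<forall>i\<in>{1..n}. l i \<le> u i) \<longrightarrow>
        (\<exists>y. feasible \<gamma> n R l u y) \<longrightarrow>
        (\<exists>t x. eval (\<gamma> = Intg) f P [VNum R, vec n a, vec n b, vec n l, vec n u] (P ! 0) t (vec n x) \<and>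
               optimal \<gamma> n a b f R l u x \<and>
               real t \<le> T n))"

end

theory Submission
  imports Defs
begin

text \<open>
  Continuous case: whatever the convex function \<open>f\<close> is, clipping \<open>a i * (t - b i)\<close> to the box is
  optimal as soon as the sum is \<open>R\<close>, because one subgradient of \<open>f\<close> at \<open>t\<close> supports all summands.
  The sum is piecewise linear and monotone in \<open>t\<close>, so \<open>t\<close> is found in linear time by prune and
  search over the breakpoints, with medians of medians as pivots.

  Integer case: rounding a continuous solution is not optimal in general. Let \<open>x\<close> and \<open>y\<close> be the
  continuous solutions for the sums \<open>R - n\<close> and \<open>R + n\<close> (truncated to the attainable range). Unit
  steps below \<open>\<lfloor>x\<rfloor>\<close> are always taken, those above \<open>\<lceil>y\<rceil>\<close> never, and at most \<open>4 * n\<close> steps remain;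
  the cheapest of these are found by one linear-time selection.
\<close>

section \<open>Evaluation as predicate transformer\<close>

text \<open>The unit steps of variable \<open>i\<close> have length \<open>1 / a i\<close> and
  offset \<open>b i\<close>, so intervals of different variables overlap, and convexity orders two
  slopes only if one interval ends before the other begins. A continuous optimum for the sum
  \<open>R\<close> therefore does not tell which steps near it to take. Shifting the sum by
  \<open>n\<close> makes counting decisive: rounding \<open>n\<close> coordinates changes a sum by
  less than \<open>n\<close>, so for the sum \<open>R + n\<close> the whole steps before the
  threshold still suffice to reach \<open>R\<close>, and every later step is at least as expensive;
  dually for \<open>R - n\<close>. Where a target is truncated, all coordinates sit at their bounds
  and no step lies beyond them. The shift and the rounding each cost \<open>n\<close> on each side,
  hence \<open>4 * n\<close>.

  No derivative of \<open>f\<close> is available. The multiplier is therefore replaced by the common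
  argument \<open>t\<close> of \<open>f\<close>, whose breakpoints depend on the box,
  \<open>a\<close> and \<open>b\<close> only. The continuous program never calls the oracle, and the
  integer program calls it only at the ends of the remaining steps.\<close>

definition wp :: "bool \<Rightarrow> (real \<Rightarrow> real) \<Rightarrow> program \<Rightarrow> val list \<Rightarrow> exp \<Rightarrow> (nat \<Rightarrow> val \<Rightarrow> bool) \<Rightarrow> bool" where
  "wp rnd f P env e Q \<longleftrightarrow> (\<exists>t v. eval rnd f P env e t v \<and> Q t v)"

definition wps :: "bool \<Rightarrow> (real \<Rightarrow> real) \<Rightarrow> program \<Rightarrow> val list \<Rightarrow> exp list \<Rightarrow> (nat \<Rightarrow> val list \<Rightarrow> bool) \<Rightarrow> bool" where
  "wps rnd f P env es Q \<longleftrightarrow> (\<exists>t vs. evals rnd f P env es t vs \<and> Q t vs)"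

text \<open>Kept apart from \<open>wp\<close> so that rewriting with \<open>wp_simps\<close> stops
  at a call; unfolding bodies there would loop on recursive functions.\<close>

definition wp_call :: "bool \<Rightarrow> (real \<Rightarrow> real) \<Rightarrow> program \<Rightarrow> nat \<Rightarrow> val list \<Rightarrow> (nat \<Rightarrow> val \<Rightarrow> bool) \<Rightarrow> bool" where
  "wp_call rnd f P g vs Q \<longleftrightarrow> g < length P \<and> wp rnd f P vs (P ! g) Q"

lemma wp_Var: "wp rnd f P env (Var i) Q \<longleftrightarrow> i < length env \<and> Q 1 (env ! i)"
  unfolding wp_def wps_def by (metis eval_cases(1) eval_Var)

lemma wp_Const: "wp rnd f P env (Const c) Q \<longleftrightarrow> Q 1 (VNum (of_int c))"
  unfolding wp_def wps_def by (metis eval_cases(2) eval_Const)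

lemma wp_Bin: "wp rnd f P env (Bin bop e1 e2) Q \<longleftrightarrow>
    wp rnd f P env e1 (\<lambda>t1 v1. wp rnd f P env e2 (\<lambda>t2 v2.
      \<exists>x y. v1 = VNum x \<and> v2 = VNum y \<and> binop_defined bop x y \<and>
        Q (1 + t1 + t2) (VNum (binop_value bop x y))))"
  by (rule iffI; unfold wp_def wps_def wp_call_def; elim exE conjE; (erule eval_cases)?;
    fastforce intro: eval_Bin)

lemma wp_Floor: "wp rnd f P env (Floor e) Q \<longleftrightarrow>
    rnd \<and> wp rnd f P env e (\<lambda>t v. \<exists>x. v = VNum x \<and> Q (1 + t) (VNum (of_int \<lfloor>x\<rfloor>)))"
  by (rule iffI; unfold wp_def wps_def wp_call_def; elim exE conjE; (erule eval_cases)?;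
    fastforce intro: eval_Floor)

lemma wp_Oracle: "wp rnd f P env (Oracle e) Q \<longleftrightarrow>
    wp rnd f P env e (\<lambda>t v. \<exists>x. v = VNum x \<and> Q (1 + t) (VNum (f x)))"
  by (rule iffI; unfold wp_def wps_def wp_call_def; elim exE conjE; (erule eval_cases)?;
    fastforce intro: eval_Oracle)

lemma wp_Empty: "wp rnd f P env Empty Q \<longleftrightarrow> Q 1 VNil"
  unfolding wp_def wps_def by (metis eval_cases(6) eval_Empty)

lemma wp_Pack: "wp rnd f P env (Pack e1 e2) Q \<longleftrightarrow>
    wp rnd f P env e1 (\<lambda>t1 v1. wp rnd f P env e2 (\<lambda>t2 v2. Q (1 + t1 + t2) (VCons v1 v2)))"
  by (rule iffI; unfold wp_def wps_def wp_call_def; elim exE conjE; (erule eval_cases)?;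
    fastforce intro: eval_Pack)

lemma wp_Head: "wp rnd f P env (Head e) Q \<longleftrightarrow>
    wp rnd f P env e (\<lambda>t v. \<exists>x y. v = VCons x y \<and> Q (1 + t) x)"
  by (rule iffI; unfold wp_def wps_def wp_call_def; elim exE conjE; (erule eval_cases)?;
    fastforce intro: eval_Head)

lemma wp_Tail: "wp rnd f P env (Tail e) Q \<longleftrightarrow>
    wp rnd f P env e (\<lambda>t v. \<exists>x y. v = VCons x y \<and> Q (1 + t) y)"
  by (rule iffI; unfold wp_def wps_def wp_call_def; elim exE conjE; (erule eval_cases)?;
    fastforce intro: eval_Tail)

lemma wp_IfLe: "wp rnd f P env (IfLe e1 e2 e3 e4) Q \<longleftrightarrow>
    wp rnd f P env e1 (\<lambda>t1 v1. wp rnd f P env e2 (\<lambda>t2 v2.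
      \<exists>x y. v1 = VNum x \<and> v2 = VNum y \<and>
        (if x \<le> y then wp rnd f P env e3 (\<lambda>t3. Q (1 + t1 + t2 + t3))
         else wp rnd f P env e4 (\<lambda>t3. Q (1 + t1 + t2 + t3)))))"
  by (rule iffI; unfold wp_def; elim exE conjE; (erule eval_cases)?;
    fastforce split: if_splits intro: eval_IfLe_True eval_IfLe_False)

lemma wp_IfEmpty: "wp rnd f P env (IfEmpty e1 e2 e3) Q \<longleftrightarrow>
    wp rnd f P env e1 (\<lambda>t1 v1.
      v1 = VNil \<and> wp rnd f P env e2 (\<lambda>t2. Q (1 + t1 + t2)) \<or>
      (\<exists>x y. v1 = VCons x y) \<and> wp rnd f P env e3 (\<lambda>t2. Q (1 + t1 + t2)))"
  by (rule iffI; unfold wp_def wps_def wp_call_def; elim exE conjE; (erule eval_cases)?;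
    fastforce intro: eval_IfEmpty_True eval_IfEmpty_False)

lemma wp_Bind: "wp rnd f P env (Bind e1 e2) Q \<longleftrightarrow>
    wp rnd f P env e1 (\<lambda>t1 v1. wp rnd f P (v1 # env) e2 (\<lambda>t2. Q (1 + t1 + t2)))"
  by (rule iffI; unfold wp_def wps_def wp_call_def; elim exE conjE; (erule eval_cases)?;
    fastforce intro: eval_Bind)

lemma wp_Call: "wp rnd f P env (Call g es) Q \<longleftrightarrow>
    wps rnd f P env es (\<lambda>t1 vs. wp_call rnd f P g vs (\<lambda>t2. Q (1 + t1 + t2)))"
  by (rule iffI; unfold wp_def wps_def wp_call_def; elim exE conjE; (erule eval_cases)?;
    fastforce intro: eval_Call)

lemma wps_Nil: "wps rnd f P env [] Q \<longleftrightarrow> Q 0 []"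
  unfolding wp_def wps_def by (metis eval_cases(14) evals_Nil)

lemma wps_Cons: "wps rnd f P env (e # es) Q \<longleftrightarrow>
    wp rnd f P env e (\<lambda>t1 v. wps rnd f P env es (\<lambda>t2 vs. Q (t1 + t2) (v # vs)))"
  by (rule iffI; unfold wp_def wps_def wp_call_def; elim exE conjE; (erule eval_cases)?;
    fastforce intro: evals_Cons)

lemmas wp_simps = wp_Var wp_Const wp_Bin wp_Floor wp_Oracle wp_Empty wp_Pack wp_Head wp_Tail
  wp_IfLe wp_IfEmpty wp_Bind wp_Call wps_Nil wps_Cons

fun lst :: "val list \<Rightarrow> val" where
  "lst [] = VNil"
| "lst (v # vs) = VCons v (lst vs)"

lemma encode_lst: "encode xs = lst (map VNum xs)"
  by (induction xs) auto

text \<open>Selection and filtering inspect only the key. The payload is the weight of a hinge in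
  the continuous search and \<open>VNil\<close> for unit steps, so one selection routine serves
  both.\<close>

abbreviation keyed :: "('a \<Rightarrow> real) \<Rightarrow> ('a \<Rightarrow> val) \<Rightarrow> 'a list \<Rightarrow> val" where
  "keyed k g xs \<equiv> lst (map (\<lambda>x. VCons (VNum (k x)) (g x)) xs)"


section \<open>The program\<close>

abbreviation "call_len x \<equiv> Call 15 [x]"
abbreviation "call_half x \<equiv> Call 2 [x]"
abbreviation "call_below p xs \<equiv> Call 3 [p, xs]"
abbreviation "call_above p xs \<equiv> Call 4 [p, xs]"
abbreviation "call_insert x xs \<equiv> Call 5 [x, xs]"
abbreviation "call_sort xs \<equiv> Call 6 [xs]"
abbreviation "call_nth xs k \<equiv> Call 7 [xs, k]"
abbreviation "call_medians n xs \<equiv> Call 8 [n, xs]"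
abbreviation "call_select xs k \<equiv> Call 9 [xs, k]"
abbreviation "call_hinges m z xs \<equiv> Call 10 [m, z, xs]"
abbreviation "call_search r s h xs \<equiv> Call 11 [r, s, h, xs]"
abbreviation "call_points a b l u \<equiv> Call 12 [a, b, l, u]"
abbreviation "call_assign t a b l u \<equiv> Call 13 [t, a, b, l, u]"
abbreviation "call_sum xs \<equiv> Call 14 [xs]"
abbreviation "call_relax r a b l u \<equiv> Call 1 [r, a, b, l, u]"
abbreviation "call_floors xs \<equiv> Call 16 [xs]"
abbreviation "call_ceilings xs \<equiv> Call 17 [xs]"
abbreviation "call_slopes a b j h \<equiv> Call 18 [a, b, j, h]"
abbreviation "call_units a b lo hi \<equiv> Call 19 [a, b, lo, hi]"
abbreviation "call_append xs ys \<equiv> Call 20 [xs, ys]"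
abbreviation "call_concat xss \<equiv> Call 21 [xss]"
abbreviation "call_fill q r lo uss \<equiv> Call 22 [q, r, lo, uss]"

definition "len_body =
  IfEmpty (Var 0) (Const 0) (Bin Plus (Const 1) (call_len (Tail (Var 0))))"

text \<open>Dropping two cells at a time halves a length without \<open>Floor\<close>, which the
  continuous program must not use.\<close>

definition "half_body =
  IfEmpty (Var 0) (Const 0)
    (IfEmpty (Tail (Var 0)) (Const 0)
      (Bin Plus (Const 1) (call_half (Tail (Tail (Var 0))))))"

definition "below_body =
  IfEmpty (Var 1) Empty
    (Bind (call_below (Var 0) (Tail (Var 1)))
      (IfLe (Var 1) (Head (Head (Var 2))) (Var 0) (Pack (Head (Var 2)) (Var 0))))"

definition "above_body =
  IfEmpty (Var 1) Empty
    (Bind (call_above (Var 0) (Tail (Var 1)))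
      (IfLe (Head (Head (Var 2))) (Var 1) (Var 0) (Pack (Head (Var 2)) (Var 0))))"

definition "insert_body =
  IfEmpty (Var 1) (Pack (Var 0) Empty)
    (IfLe (Head (Var 0)) (Head (Head (Var 1))) (Pack (Var 0) (Var 1))
      (Pack (Head (Var 1)) (call_insert (Var 0) (Tail (Var 1)))))"

definition "sort_body =
  IfEmpty (Var 0) Empty (call_insert (Head (Var 0)) (call_sort (Tail (Var 0))))"

definition "nth_body =
  IfLe (Var 1) (Const 0) (Head (Var 0)) (call_nth (Tail (Var 0)) (Bin Minus (Var 1) (Const 1)))"

definition "medians_body =
  IfLe (Const 5) (Var 0)
    (Pack
      (call_nth
        (call_sort
          (Pack (Head (Var 1)) (Pack (Head (Tail (Var 1))) (Pack (Head (Tail (Tail (Var 1))))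
            (Pack (Head (Tail (Tail (Tail (Var 1)))))
              (Pack (Head (Tail (Tail (Tail (Tail (Var 1)))))) Empty))))))
        (Const 2))
      (call_medians (Bin Minus (Var 0) (Const 5)) (Tail (Tail (Tail (Tail (Tail (Var 1))))))))
    Empty"

definition "select_body =
  Bind (call_len (Var 0))                                      \<comment> \<open>environment from here on: \<open>[n, xs, k]\<close>\<close>
    (IfLe (Var 0) (Const 24) (Head (call_nth (call_sort (Var 1)) (Var 2)))
      (Bind (call_medians (Var 0) (Var 1))                     \<comment> \<open>\<open>[ms, n, xs, k]\<close>\<close>
      (Bind (call_select (Var 0) (call_half (Var 0)))          \<comment> \<open>\<open>[p, ms, n, xs, k]\<close>\<close>
      (Bind (call_below (Var 0) (Var 3))                       \<comment> \<open>\<open>[lt, p, ms, n, xs, k]\<close>\<close>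
      (Bind (call_len (Var 0))                                 \<comment> \<open>\<open>[c, lt, p, ms, n, xs, k]\<close>\<close>
      (IfLe (Var 0) (Var 6)
        (Bind (call_above (Var 2) (Var 5))                     \<comment> \<open>\<open>[gt, c, lt, p, ms, n, xs, k]\<close>\<close>
        (Bind (Bin Minus (Var 5) (call_len (Var 0)))           \<comment> \<open>\<open>[d, gt, c, lt, p, ms, n, xs, k]\<close>\<close>
        (IfLe (Var 0) (Var 8)
          (call_select (Var 1) (Bin Minus (Var 8) (Var 0)))
          (Var 4))))
        (call_select (Var 1) (Var 6))))))))"

definition "hinges_body =
  IfEmpty (Var 2) (Const 0)
    (Bind (call_hinges (Var 0) (Var 1) (Tail (Var 2)))
      (IfLe (Head (Head (Var 3))) (Var 1)
        (Bin Plus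
          (Bin Times (Tail (Head (Var 3))) (Bin Minus (Var 2) (Head (Head (Var 3)))))
          (Var 0))
        (Var 0)))"

definition "search_body =
  IfEmpty (Var 3)
    (IfLe (Var 1) (Const 0)
      (IfLe (Const 0) (Var 1) (Var 2) (Bin Divide (Var 0) (Var 1)))
      (Bin Divide (Var 0) (Var 1)))
    (Bind (call_select (Var 3) (call_half (Var 3)))            \<comment> \<open>\<open>[m, r, s, h, xs]\<close>\<close>
      (IfLe (Var 1)
        (Bin Plus (Bin Times (Var 2) (Var 0)) (call_hinges (Var 0) (Var 0) (Var 4)))
        (call_search (Var 1) (Var 2) (Var 0) (call_below (Var 0) (Var 4)))
        (Bind (call_hinges (Var 0) (Const 0) (Var 4))          \<comment> \<open>\<open>[c, m, r, s, h, xs]\<close>\<close>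
          (call_search
            (Bin Minus (Var 2) (Var 0))
            (Bin Plus (Var 3) (Bin Minus (call_hinges (Var 1) (Const 1) (Var 5)) (Var 0)))
            (Var 1)
            (call_above (Var 1) (Var 5))))))"

definition "points_body =
  IfEmpty (Var 0) Empty
    (Pack
      (Pack (Bin Plus (Bin Divide (Head (Var 2)) (Head (Var 0))) (Head (Var 1))) (Head (Var 0)))
      (Pack
        (Pack (Bin Plus (Bin Divide (Head (Var 3)) (Head (Var 0))) (Head (Var 1)))
          (Bin Minus (Const 0) (Head (Var 0))))
        (call_points (Tail (Var 0)) (Tail (Var 1)) (Tail (Var 2)) (Tail (Var 3)))))"

definition "assign_body =
  IfEmpty (Var 1) Empty
    (Pack
      (Bind (Bin Times (Head (Var 1)) (Bin Minus (Var 0) (Head (Var 2))))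
        (IfLe (Var 0) (Head (Var 4)) (Head (Var 4))
          (IfLe (Head (Var 5)) (Var 0) (Head (Var 5)) (Var 0))))
      (call_assign (Var 0) (Tail (Var 1)) (Tail (Var 2)) (Tail (Var 3)) (Tail (Var 4))))"

definition "sum_body =
  IfEmpty (Var 0) (Const 0) (Bin Plus (Head (Var 0)) (call_sum (Tail (Var 0))))"

definition "relax_body =
  call_assign
    (call_search (Bin Minus (Var 0) (call_sum (Var 3))) (Const 0) (Const 0)
      (call_points (Var 1) (Var 2) (Var 3) (Var 4)))
    (Var 1) (Var 2) (Var 3) (Var 4)"

definition "floors_body =
  IfEmpty (Var 0) Empty (Pack (Floor (Head (Var 0))) (call_floors (Tail (Var 0))))"

definition "ceilings_body =
  IfEmpty (Var 0) Empty
    (Pack (Bin Minus (Const 0) (Floor (Bin Minus (Const 0) (Head (Var 0)))))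
      (call_ceilings (Tail (Var 0))))"

definition "slopes_body =
  IfLe (Var 3) (Var 2) Empty
    (Pack
      (Pack
        (Bin Times (Var 0)
          (Bin Minus
            (Oracle (Bin Plus (Bin Divide (Bin Plus (Var 2) (Const 1)) (Var 0)) (Var 1)))
            (Oracle (Bin Plus (Bin Divide (Var 2) (Var 0)) (Var 1)))))
        Empty)
      (call_slopes (Var 0) (Var 1) (Bin Plus (Var 2) (Const 1)) (Var 3)))"

definition "units_body =
  IfEmpty (Var 0) Empty
    (Pack (call_slopes (Head (Var 0)) (Head (Var 1)) (Head (Var 2)) (Head (Var 3)))
      (call_units (Tail (Var 0)) (Tail (Var 1)) (Tail (Var 2)) (Tail (Var 3))))"

definition "append_body =
  IfEmpty (Var 0) (Var 1) (Pack (Head (Var 0)) (call_append (Tail (Var 0)) (Var 1)))"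

definition "concat_body =
  IfEmpty (Var 0) Empty (call_append (Head (Var 0)) (call_concat (Tail (Var 0))))"

definition "fill_body =
  IfEmpty (Var 2) Empty
    (Bind (call_len (call_below (Var 0) (Head (Var 3))))       \<comment> \<open>\<open>[c, q, r, lo, uss]\<close>\<close>
    (Bind (Bin Minus
        (Bin Minus (call_len (Head (Var 4))) (call_len (call_above (Var 1) (Head (Var 4)))))
        (Var 0))                                               \<comment> \<open>\<open>[d, c, q, r, lo, uss]\<close>\<close>
      (IfLe (Var 0) (Var 3)
        (Pack (Bin Plus (Head (Var 4)) (Bin Plus (Var 1) (Var 0)))
          (call_fill (Var 2) (Bin Minus (Var 3) (Var 0)) (Tail (Var 4)) (Tail (Var 5))))
        (Pack (Bin Plus (Head (Var 4)) (Bin Plus (Var 1) (Var 3)))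
          (call_fill (Var 2) (Const 0) (Tail (Var 4)) (Tail (Var 5)))))))"

definition "continuous_main = call_relax (Var 0) (Var 1) (Var 2) (Var 3) (Var 4)"

definition "integer_main =
  Bind (call_ceilings (Var 3))
  (Bind (call_floors (Var 5))
  (Bind (call_sum (Var 1))                            \<comment> \<open>\<open>[L, u', l', r, a, b, l, u]\<close>\<close>
  (IfLe (Var 3) (Var 0) (Var 2)
  (Bind (call_len (Var 4))                            \<comment> \<open>\<open>[n, L, u', l', r, a, b, l, u]\<close>\<close>
  (Bind (IfLe (Bin Minus (Var 4) (Var 0)) (Var 1) (Var 1) (Bin Minus (Var 4) (Var 0)))
  (Bind (call_sum (Var 3))                            \<comment> \<open>\<open>[U, r1, n, L, u', l', r, a, b, l, u]\<close>\<close>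
  (Bind (IfLe (Bin Plus (Var 6) (Var 2)) (Var 0) (Bin Plus (Var 6) (Var 2)) (Var 0))
                                                      \<comment> \<open>\<open>[r2, U, r1, n, L, u', l', r, a, b, l, u]\<close>\<close>
  (Bind (call_floors (call_relax (Var 2) (Var 8) (Var 9) (Var 6) (Var 5)))
  (Bind (call_ceilings (call_relax (Var 1) (Var 9) (Var 10) (Var 7) (Var 6)))
                                                      \<comment> \<open>\<open>[hi, lo, r2, U, r1, n, L, u', l', r, a, b, l, u]\<close>\<close>
  (Bind (call_units (Var 10) (Var 11) (Var 1) (Var 0))
  (Bind (call_concat (Var 0))                         \<comment> \<open>\<open>[us, uss, hi, lo, r2, U, r1, n, L, u', l', r, a, b, l, u]\<close>\<close>
  (Bind (Bin Minus (Var 11) (call_sum (Var 3)))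
  (Bind (call_select (Var 1) (Bin Minus (Var 0) (Const 1)))
                                                      \<comment> \<open>\<open>[q, k, us, uss, hi, lo, r2, U, \<dots>]\<close>\<close>
    (call_fill (Var 0) (Bin Minus (Var 1) (call_len (call_below (Var 0) (Var 2))))
      (Var 5) (Var 3)))))))))))))))"

text \<open>Numbering starts at 1, because a main function is put in front.\<close>

definition library :: program where
  "library = [relax_body, half_body, below_body, above_body, insert_body, sort_body, nth_body,
     medians_body, select_body, hinges_body, search_body, points_body, assign_body, sum_body,
     len_body, floors_body, ceilings_body, slopes_body, units_body, append_body, concat_body,
     fill_body]"

locale machine =
  fixes rnd :: bool and f :: "real \<Rightarrow> real" and main :: exp
begin

abbreviation "prog \<equiv> main # library"

definition computes :: "nat \<Rightarrow> val list \<Rightarrow> nat \<Rightarrow> val \<Rightarrow> bool" where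
  "computes g vs T v \<longleftrightarrow> wp_call rnd f prog g vs (\<lambda>t w. t \<le> T \<and> w = v)"

text \<open>Determinism turns a bounded call into a rewrite rule: for one fixed
  \<open>t \<le> T\<close>, a postcondition holds of the call iff it holds of \<open>t\<close> and
  \<open>v\<close>. The running-time proofs feed their callees to \<open>simp\<close> in this form,
  which leaves arithmetic on the times.\<close>

lemma computesE:
  assumes "computes g vs T v"
  obtains t where "t \<le> T" "\<And>Q. wp_call rnd f prog g vs Q = Q t v"
proof -
  obtain t where t: "g < length prog" "eval rnd f prog vs (prog ! g) t v" "t \<le> T"
    using assms by (auto simp: computes_def wp_call_def wp_def)
  then have "wp_call rnd f prog g vs Q = Q t v" for Q
    using eval_iff(1)[OF t(2)] by (auto simp: wp_call_def wp_def)
  with t(3) that show thesis by blast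
qed

lemma wp_bodies:
  "wp_call rnd f prog 15 vs Q = wp rnd f prog vs len_body Q"
  "wp_call rnd f prog 2 vs Q = wp rnd f prog vs half_body Q"
  "wp_call rnd f prog 3 vs Q = wp rnd f prog vs below_body Q"
  "wp_call rnd f prog 4 vs Q = wp rnd f prog vs above_body Q"
  "wp_call rnd f prog 5 vs Q = wp rnd f prog vs insert_body Q"
  "wp_call rnd f prog 6 vs Q = wp rnd f prog vs sort_body Q"
  "wp_call rnd f prog 7 vs Q = wp rnd f prog vs nth_body Q"
  "wp_call rnd f prog 8 vs Q = wp rnd f prog vs medians_body Q"
  "wp_call rnd f prog 9 vs Q = wp rnd f prog vs select_body Q"
  "wp_call rnd f prog 10 vs Q = wp rnd f prog vs hinges_body Q"
  "wp_call rnd f prog 11 vs Q = wp rnd f prog vs search_body Q"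
  "wp_call rnd f prog 12 vs Q = wp rnd f prog vs points_body Q"
  "wp_call rnd f prog 13 vs Q = wp rnd f prog vs assign_body Q"
  "wp_call rnd f prog 14 vs Q = wp rnd f prog vs sum_body Q"
  "wp_call rnd f prog 1 vs Q = wp rnd f prog vs relax_body Q"
  "wp_call rnd f prog 16 vs Q = wp rnd f prog vs floors_body Q"
  "wp_call rnd f prog 17 vs Q = wp rnd f prog vs ceilings_body Q"
  "wp_call rnd f prog 18 vs Q = wp rnd f prog vs slopes_body Q"
  "wp_call rnd f prog 19 vs Q = wp rnd f prog vs units_body Q"
  "wp_call rnd f prog 20 vs Q = wp rnd f prog vs append_body Q"
  "wp_call rnd f prog 21 vs Q = wp rnd f prog vs concat_body Q"
  "wp_call rnd f prog 22 vs Q = wp rnd f prog vs fill_body Q"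
  by (simp_all add: wp_call_def library_def)

end


section \<open>Running times of the basic functions\<close>

definition clip :: "real \<Rightarrow> real \<Rightarrow> real \<Rightarrow> real" where
  "clip l u v = (if v \<le> l then l else if u \<le> v then u else v)"

definition slope :: "(real \<Rightarrow> real) \<Rightarrow> real \<Rightarrow> real \<Rightarrow> real \<Rightarrow> real" where
  "slope f a b x = a * (f ((x + 1) / a + b) - f (x / a + b))"

definition points ::
  "(nat \<Rightarrow> real) \<Rightarrow> (nat \<Rightarrow> real) \<Rightarrow> (nat \<Rightarrow> real) \<Rightarrow> (nat \<Rightarrow> real) \<Rightarrow> nat list \<Rightarrow> (real \<times> real) list" where
  "points a b l u is = concat (map (\<lambda>i. [(l i / a i + b i, a i), (u i / a i + b i, - a i)]) is)"

text \<open>The cut \<open>m\<close> and the argument \<open>z\<close> are separate: the hinges up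
  to \<open>m\<close> form an affine function of \<open>z\<close>. Arguments 0 and 1 reveal its
  intercept and slope, and \<open>z = m\<close> gives the value of the piecewise linear function at
  \<open>m\<close>.\<close>

definition hinges :: "real \<Rightarrow> real \<Rightarrow> (real \<times> real) list \<Rightarrow> real" where
  "hinges m z ps = (\<Sum>(p, w)\<leftarrow>filter (\<lambda>(p, w). p \<le> m) ps. w * (z - p))"

fun medians :: "('a \<Rightarrow> real) \<Rightarrow> 'a list \<Rightarrow> 'a list" where
  "medians k (x1 # x2 # x3 # x4 # x5 # xs) = sort_key k [x1, x2, x3, x4, x5] ! 2 # medians k xs"
| "medians k xs = []"

context machine
begin

lemma computes_len: "computes 15 [lst xs] (7 * length xs + 3) (VNum (length xs))"
proof (induction xs)
  case (Cons x xs)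
  show ?case
    unfolding computes_def wp_bodies
    by (rule computesE[OF Cons]) (simp add: len_body_def wp_simps)
qed (unfold computes_def wp_bodies, simp add: len_body_def wp_simps)

lemma computes_half: "computes 2 [lst xs] (6 * length xs + 3) (VNum (length xs div 2))"
proof (induction xs rule: induct_list012)
  case (3 x y xs)
  show ?case
    unfolding computes_def wp_bodies
    by (rule computesE[OF 3(1)]) (simp add: half_body_def wp_simps)
qed (unfold computes_def wp_bodies, simp_all add: half_body_def wp_simps)

lemma computes_below:
  "computes 3 [VNum p, keyed k g xs] (16 * length xs + 3) (keyed k g (filter (\<lambda>x. k x < p) xs))"
proof (induction xs)
  case (Cons x xs)
  show ?case
    unfolding computes_def wp_bodies
    by (rule computesE[OF Cons]) (simp add: below_body_def wp_simps not_le)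
qed (unfold computes_def wp_bodies, simp_all add: below_body_def wp_simps)

lemma computes_above:
  "computes 4 [VNum p, keyed k g xs] (16 * length xs + 3) (keyed k g (filter (\<lambda>x. p < k x) xs))"
proof (induction xs)
  case (Cons x xs)
  show ?case
    unfolding computes_def wp_bodies
    by (rule computesE[OF Cons]) (simp add: above_body_def wp_simps not_le)
qed (unfold computes_def wp_bodies, simp_all add: above_body_def wp_simps)

lemma computes_insert:
  "computes 5 [VCons (VNum (k x)) (g x), keyed k g xs] (15 * length xs + 5) (keyed k g (insort_key k x xs))"
proof (induction xs)
  case (Cons y xs)
  show ?case
    unfolding computes_def wp_bodies
    by (rule computesE[OF Cons]) (simp add: insert_body_def wp_simps)
qed (unfold computes_def wp_bodies, simp_all add: insert_body_def wp_simps)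

lemma computes_sort:
  "computes 6 [keyed k g xs] (15 * length xs * length xs + 15 * length xs + 3) (keyed k g (sort_key k xs))"
proof (induction xs)
  case (Cons x xs)
  show ?case
    unfolding computes_def wp_bodies
    by (rule computesE[OF Cons], rule computesE[OF computes_insert[of k x g "sort_key k xs"]])
      (simp add: sort_body_def wp_simps algebra_simps)
qed (unfold computes_def wp_bodies, simp_all add: sort_body_def wp_simps)

lemma computes_nth:
  "j < length xs \<Longrightarrow> computes 7 [lst xs, VNum (real j)] (9 * j + 5) (xs ! j)"
proof (induction xs arbitrary: j)
  case (Cons x xs)
  show ?case
  proof (cases j)
    case 0
    then show ?thesis unfolding computes_def wp_bodies by (simp add: nth_body_def wp_simps)
  next
    case (Suc i)
    then have IH: "computes 7 [lst xs, VNum (real i)] (9 * i + 5) (xs ! i)"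
      using Cons by simp
    show ?thesis
      unfolding computes_def wp_bodies Suc
      by (rule computesE[OF IH]) (simp add: nth_body_def wp_simps)
  qed
qed simp

lemma computes_medians:
  "computes 8 [VNum (real (length xs)), keyed k g xs] (150 * length xs + 4) (keyed k g (medians k xs))"
proof (induction k xs rule: medians.induct)
  case (1 k x1 x2 x3 x4 x5 xs)
  let ?s = "sort_key k [x1, x2, x3, x4, x5]"
  have n: "computes 7 [keyed k g ?s, VNum 2] 23 (VCons (VNum (k (?s ! 2))) (g (?s ! 2)))"
    using computes_nth[of 2 "map (\<lambda>x. VCons (VNum (k x)) (g x)) ?s"] by simp
  show ?case
    unfolding computes_def wp_bodies
    by (rule computesE[OF 1], rule computesE[OF n],
        rule computesE[OF computes_sort[of k g "[x1, x2, x3, x4, x5]"]])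
      (simp add: medians_body_def wp_simps del: sort_key_simps)
qed (unfold computes_def wp_bodies, simp_all add: medians_body_def wp_simps)

lemma computes_hinges:
  "computes 10 [VNum m, VNum z, keyed fst (VNum \<circ> snd) ps] (30 * length ps + 3) (VNum (hinges m z ps))"
proof (induction ps)
  case (Cons q ps)
  show ?case
    unfolding computes_def wp_bodies
    by (rule computesE[OF Cons]) (simp add: hinges_body_def wp_simps hinges_def split_beta)
qed (unfold computes_def wp_bodies, simp_all add: hinges_body_def wp_simps hinges_def)

lemma computes_points:
  assumes "\<forall>i\<in>set is. a i \<noteq> 0"
  shows "computes 12 [encode (map a is), encode (map b is), encode (map l is), encode (map u is)]
    (60 * length is + 3) (keyed fst (VNum \<circ> snd) (points a b l u is))"
  using assms
proof (induction "is")
  case (Cons i "is")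
  then have IH: "computes 12 [encode (map a is), encode (map b is), encode (map l is), encode (map u is)]
    (60 * length is + 3) (keyed fst (VNum \<circ> snd) (points a b l u is))" by simp
  show ?case
    unfolding computes_def wp_bodies
    by (rule computesE[OF IH]) (use Cons.prems in \<open>simp add: points_body_def wp_simps points_def\<close>)
qed (unfold computes_def wp_bodies, simp_all add: points_body_def wp_simps points_def)

lemma computes_assign:
  "computes 13 [VNum t, encode (map a is), encode (map b is), encode (map l is), encode (map u is)]
    (60 * length is + 3) (encode (map (\<lambda>i. clip (l i) (u i) (a i * (t - b i))) is))"
proof (induction "is")
  case (Cons i "is")
  show ?case
    unfolding computes_def wp_bodies
    by (rule computesE[OF Cons]) (simp add: assign_body_def wp_simps clip_def)
qed (unfold computes_def wp_bodies, simp_all add: assign_body_def wp_simps)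

lemma computes_sum: "computes 14 [encode xs] (10 * length xs + 3) (VNum (sum_list xs))"
proof (induction xs)
  case (Cons x xs)
  show ?case
    unfolding computes_def wp_bodies
    by (rule computesE[OF Cons]) (simp add: sum_body_def wp_simps)
qed (unfold computes_def wp_bodies, simp_all add: sum_body_def wp_simps)

lemma computes_floors:
  assumes rnd
  shows "computes 16 [encode (map x is)] (20 * length is + 3) (encode (map (\<lambda>i. of_int \<lfloor>x i\<rfloor>) is))"
proof (induction "is")
  case (Cons i "is")
  show ?case
    unfolding computes_def wp_bodies
    by (rule computesE[OF Cons]) (simp add: floors_body_def wp_simps assms)
qed (unfold computes_def wp_bodies, simp_all add: floors_body_def wp_simps)

lemma computes_ceilings:
  assumes rnd
  shows "computes 17 [encode (map x is)] (20 * length is + 3) (encode (map (\<lambda>i. of_int \<lceil>x i\<rceil>) is))"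
proof (induction "is")
  case (Cons i "is")
  show ?case
    unfolding computes_def wp_bodies
    by (rule computesE[OF Cons]) (simp add: ceilings_body_def wp_simps assms ceiling_def)
qed (unfold computes_def wp_bodies, simp_all add: ceilings_body_def wp_simps)

lemma computes_slopes:
  assumes "a \<noteq> 0"
  shows "computes 18 [VNum a, VNum b, VNum j, VNum (j + real m)] (40 * m + 4)
    (keyed (\<lambda>s. s) (\<lambda>_. VNil) (map (\<lambda>r. slope f a b (j + real r)) [0..<m]))"
proof (induction m arbitrary: j)
  case (Suc m)
  have *: "map (\<lambda>r. slope f a b (j + real r)) [0..<Suc m] =
      slope f a b j # map (\<lambda>r. slope f a b (j + 1 + real r)) [0..<m]"
    by (simp add: map_upt_Suc del: upt_Suc add: algebra_simps)
  show ?case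
    unfolding computes_def wp_bodies *
    by (rule computesE[OF Suc[of "j + 1"]])
      (use assms in \<open>simp add: slopes_body_def wp_simps slope_def add.assoc\<close>)
qed (unfold computes_def wp_bodies, simp_all add: slopes_body_def wp_simps)

lemma computes_append: "computes 20 [lst xs, lst ys] (15 * length xs + 3) (lst (xs @ ys))"
proof (induction xs)
  case (Cons x xs)
  show ?case
    unfolding computes_def wp_bodies
    by (rule computesE[OF Cons]) (simp add: append_body_def wp_simps)
qed (unfold computes_def wp_bodies, simp_all add: append_body_def wp_simps)

lemma computes_concat:
  "computes 21 [lst (map lst xss)] (15 * length (concat xss) + 15 * length xss + 3) (lst (concat xss))"
proof (induction xss)
  case (Cons xs xss)
  show ?case
    unfolding computes_def wp_bodies
    by (rule computesE[OF Cons], rule computesE[OF computes_append[of xs "concat xss"]])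
      (simp add: concat_body_def wp_simps)
qed (unfold computes_def wp_bodies, simp_all add: concat_body_def wp_simps)

end


section \<open>Linear-time selection\<close>

lemma length_medians: "length (medians k xs) = length xs div 5"
  by (induction k xs rule: medians.induct) auto

lemma length_filter_sort_key: "length (filter P (sort_key k xs)) = length (filter P xs)"
  by (metis mset_filter mset_sort size_mset)

lemma length_filter_mono:
  "(\<And>x. P x \<Longrightarrow> Q x) \<Longrightarrow> length (filter P xs) \<le> length (filter Q xs)"
  by (induction xs) auto

lemma sort_map: "sort (map k xs) = map k (sort_key k xs)"
  by (rule properties_for_sort) auto

lemma length_filter_sort: "length (filter P (sort xs)) = length (filter P xs)"
  by (rule length_filter_sort_key)

lemma length_filter_le_nth:
  assumes "sorted (map k xs)" "i < length xs"
  shows "i < length (filter (\<lambda>x. k x \<le> k (xs ! i)) xs)"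
    and "length xs - i \<le> length (filter (\<lambda>x. k (xs ! i) \<le> k x) xs)"
proof -
  have *: "k (xs ! j) \<le> k (xs ! j')" if "j \<le> j'" "j' < length xs" for j j'
    using sorted_nth_mono[OF assms(1), of j j'] that by simp
  have "{..i} \<subseteq> {j. j < length xs \<and> k (xs ! j) \<le> k (xs ! i)}"
    using assms(2) * by auto
  from card_mono[OF _ this] show "i < length (filter (\<lambda>x. k x \<le> k (xs ! i)) xs)"
    by (simp add: length_filter_conv_card)
  have "{i..<length xs} \<subseteq> {j. j < length xs \<and> k (xs ! i) \<le> k (xs ! j)}"
    using assms(2) * by auto
  from card_mono[OF _ this] show "length xs - i \<le> length (filter (\<lambda>x. k (xs ! i) \<le> k x) xs)"
    by (simp add: length_filter_conv_card)
qed

text \<open>A median on one side of \<open>p\<close> brings three members of its block of five to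
  that side, and the blocks are disjoint.\<close>

lemma length_filter_medians:
  "3 * length (filter (\<lambda>x. k x \<le> p) (medians k xs)) \<le> length (filter (\<lambda>x. k x \<le> p) xs)"
  "3 * length (filter (\<lambda>x. p \<le> k x) (medians k xs)) \<le> length (filter (\<lambda>x. p \<le> k x) xs)"
proof (induction k xs rule: medians.induct)
  case (1 k x1 x2 x3 x4 x5 xs)
  let ?g = "[x1, x2, x3, x4, x5]"
  let ?s = "sort_key k ?g"
  have len: "2 < length ?s" by (simp del: sort_key_simps)
  have le: "length (filter Q ?s) \<le> length (filter P ?g)"
    if "\<And>x. Q x \<Longrightarrow> P x" for P Q
    unfolding length_filter_sort_key using that by (rule length_filter_mono)
  { case 1
    have "k (?s ! 2) \<le> p \<longrightarrow> 3 \<le> length (filter (\<lambda>x. k x \<le> p) ?g)"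
      using length_filter_le_nth(1)[of k ?s 2] len le[of "\<lambda>x. k x \<le> k (?s ! 2)" "\<lambda>x. k x \<le> p"]
      by (force simp del: sort_key_simps filter.simps)
    then show ?case using "1.IH"(1) by (simp del: sort_key_simps split: if_splits) }
  { case 2
    have "p \<le> k (?s ! 2) \<longrightarrow> 3 \<le> length (filter (\<lambda>x. p \<le> k x) ?g)"
      using length_filter_le_nth(2)[of k ?s 2] len le[of "\<lambda>x. k (?s ! 2) \<le> k x" "\<lambda>x. p \<le> k x"]
      by (force simp del: sort_key_simps filter.simps)
    then show ?case using "1.IH"(2) by (simp del: sort_key_simps split: if_splits) }
qed auto

lemma sort_partition:
  fixes xs :: "real list"
  shows "sort xs = sort (filter (\<lambda>x. x < p) xs) @
    replicate (length (filter (\<lambda>x. x = p) xs)) p @ sort (filter (\<lambda>x. p < x) xs)"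
proof (rule properties_for_sort)
  show "mset (sort (filter (\<lambda>x. x < p) xs) @
    replicate (length (filter (\<lambda>x. x = p) xs)) p @ sort (filter (\<lambda>x. p < x) xs)) = mset xs"
    by (induction xs) auto
qed (auto simp: sorted_append)

lemma length_filter_trichotomy:
  fixes k :: "'a \<Rightarrow> real"
  shows "length (filter (\<lambda>x. k x < p) xs) + length (filter (\<lambda>x. p \<le> k x) xs) = length xs"
    and "length (filter (\<lambda>x. p < k x) xs) + length (filter (\<lambda>x. k x \<le> p) xs) = length xs"
    and "length (filter (\<lambda>x. k x < p) xs) + length (filter (\<lambda>x. k x = p) xs)
      + length (filter (\<lambda>x. p < k x) xs) = length xs"
  by (induction xs) auto

text \<open>The nested conditionals follow the branches of \<open>select_body\<close>. Keys equal to
  the pivot enter neither recursive call, so ties cannot spoil the shrinking.\<close>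

lemma nth_sort_partition:
  fixes k :: "'a \<Rightarrow> real" and p :: real
  assumes "j < length xs"
  defines "lt \<equiv> filter (\<lambda>x. k x < p) xs" and "gt \<equiv> filter (\<lambda>x. p < k x) xs"
  shows "sort (map k xs) ! j =
    (if length lt \<le> j
     then if length xs - length gt \<le> j then sort (map k gt) ! (j - (length xs - length gt)) else p
     else sort (map k lt) ! j)"
proof -
  have "length lt + length (filter (\<lambda>x. k x = p) xs) + length gt = length xs"
    using length_filter_trichotomy(3)[where k = k and p = p and xs = xs] by (simp add: lt_def gt_def)
  then have "length lt + length (filter (\<lambda>x. k x = p) xs) = length xs - length gt" by simp
  then show ?thesis
    using assms(1) by (subst sort_partition[of _ p])
      (auto simp: nth_append filter_map comp_def diff_diff_left simp flip: lt_def gt_def)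
qed

lemma length_filter_nth_sort:
  fixes k :: "'a \<Rightarrow> real"
  assumes "i < length xs"
  shows "i < length (filter (\<lambda>x. k x \<le> sort (map k xs) ! i) xs)"
    and "length xs - i \<le> length (filter (\<lambda>x. sort (map k xs) ! i \<le> k x) xs)"
proof -
  let ?p = "sort (map k xs) ! i"
  have "length (filter P (sort (map k xs))) = length (filter (\<lambda>x. P (k x)) xs)" for P
    unfolding length_filter_sort by (simp add: filter_map comp_def)
  with length_filter_le_nth[of "\<lambda>x. x" "sort (map k xs)" i] assms
  show "i < length (filter (\<lambda>x. k x \<le> ?p) xs)"
    and "length xs - i \<le> length (filter (\<lambda>x. ?p \<le> k x) xs)"
    by simp_all
qed

text \<open>From \<open>2 * h \<le> m\<close> and \<open>n \<le> 5 * m + 4\<close>, at least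
  \<open>3 * (n - 4) / 10\<close> keys are not below \<open>p\<close>, which leaves at most
  \<open>(7 * n + 12) / 10\<close> below it. The 12 stems from the up to four elements outside the
  blocks; the other side satisfies an even better bound.\<close>

lemma median_of_medians_split:
  fixes k :: "'a \<Rightarrow> real"
  assumes "5 \<le> length xs"
  defines "p \<equiv> sort (map k (medians k xs)) ! (length (medians k xs) div 2)"
  shows "10 * length (filter (\<lambda>x. k x < p) xs) \<le> 7 * length xs + 12"
    and "10 * length (filter (\<lambda>x. p < k x) xs) \<le> 7 * length xs + 12"
proof -
  define n where "n = length xs"
  define m where "m = length (medians k xs)"
  define h where "h = m div 2"
  have m: "m = n div 5" "0 < m"
    using assms(1) by (simp_all add: m_def n_def length_medians)
  then have h: "m \<le> 2 * h + 1" "2 * h \<le> m" "n \<le> 5 * m + 4" "h < length (medians k xs)"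
    unfolding h_def by (simp_all flip: m_def)
  from length_filter_nth_sort[OF h(4), of k]
  have "h < length (filter (\<lambda>x. k x \<le> p) (medians k xs))"
    "m - h \<le> length (filter (\<lambda>x. p \<le> k x) (medians k xs))"
    unfolding p_def m_def h_def .
  with length_filter_medians[where k = k and p = p and xs = xs]
  have "3 * (h + 1) \<le> length (filter (\<lambda>x. k x \<le> p) xs)"
    "3 * (m - h) \<le> length (filter (\<lambda>x. p \<le> k x) xs)"
    by simp_all
  then have *: "3 * h + 3 \<le> length (filter (\<lambda>x. k x \<le> p) xs)" "length xs \<le> 10 * h + 9"
    "3 * (m - h) \<le> length (filter (\<lambda>x. p \<le> k x) xs)" "length xs \<le> 10 * (m - h) + 4"
    using h(1-3) by (simp_all add: n_def)
  show "10 * length (filter (\<lambda>x. k x < p) xs) \<le> 7 * length xs + 12"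
    using length_filter_trichotomy(1)[of k p xs] *(3,4) by linarith
  show "10 * length (filter (\<lambda>x. p < k x) xs) \<le> 7 * length xs + 12"
    using length_filter_trichotomy(2)[of p k xs] *(1,2) by linarith
qed

context machine
begin

lemma computes_mono:
  assumes "computes g vs T v" "T \<le> T'"
  shows "computes g vs T' v"
  using assms(2) unfolding computes_def by (rule_tac computesE[OF assms(1)]) simp

lemma computes_len_keyed: "computes 15 [keyed k g xs] (7 * length xs + 3) (VNum (length xs))"
  using computes_len[of "map (\<lambda>x. VCons (VNum (k x)) (g x)) xs"] by simp

lemma computes_half_keyed: "computes 2 [keyed k g xs] (6 * length xs + 3) (VNum (length xs div 2))"
  using computes_half[of "map (\<lambda>x. VCons (VNum (k x)) (g x)) xs"] by simp

lemma computes_select: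
  "j < length xs \<Longrightarrow>
    computes 9 [keyed k g xs, VNum (real j)] (5000 * length xs) (VNum (sort (map k xs) ! j))"
proof (induction "length xs" arbitrary: xs j rule: less_induct)
  case less
  let ?n = "length xs"
  show ?case
  proof (cases "?n \<le> 24")
    case True
    have nth: "computes 7 [keyed k g (sort_key k xs), VNum (real j)] (9 * j + 5)
        (VCons (VNum (sort (map k xs) ! j)) (g (sort_key k xs ! j)))"
      using computes_nth[of j "map (\<lambda>x. VCons (VNum (k x)) (g x)) (sort_key k xs)"] less.prems
      by (simp add: sort_map)
    \<comment> \<open>At most 24 elements: \<open>15 * n * n + 15 * n \<le> 375 * n\<close>.\<close>
    have sort: "computes 6 [keyed k g xs] (375 * ?n + 3) (keyed k g (sort_key k xs))"
      by (rule computes_mono[OF computes_sort]) (use True in \<open>simp add: mult_le_mono\<close>)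
    with True show ?thesis
      unfolding computes_def wp_bodies
      by (rule_tac computesE[OF computes_len_keyed[of k g xs]], rule_tac computesE[OF sort],
          rule_tac computesE[OF nth])
        (use less.prems in \<open>simp add: select_body_def wp_simps\<close>)
  next
    case False
    define ms where "ms = medians k xs"
    define m where "m = length ms"
    define h where "h = m div 2"
    define p where "p = sort (map k ms) ! h"
    define lt where "lt = filter (\<lambda>x. k x < p) xs"
    define gt where "gt = filter (\<lambda>x. p < k x) xs"
    have m: "5 * m \<le> ?n" "0 < m" "h < length ms"
      using False by (auto simp: m_def h_def ms_def length_medians)
    have split: "10 * length lt \<le> 7 * ?n + 12" "10 * length gt \<le> 7 * ?n + 12"
      using median_of_medians_split[of xs k, folded ms_def, folded m_def, folded h_def, folded p_def] False
      by (auto simp: lt_def gt_def)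
    note nth = nth_sort_partition[OF less.prems, of k p, folded lt_def gt_def]
    have pivot: "computes 9 [keyed k g ms, VNum (real h)] (5000 * m) (VNum p)"
      unfolding m_def p_def using m by (intro less.hyps) (auto simp: m_def)
    note calls = computes_len_keyed[of k g xs] computes_medians[of xs k g, folded ms_def]
      computes_half_keyed[of k g ms, folded m_def, folded h_def] pivot
      computes_below[of p k g xs, folded lt_def] computes_len_keyed[of k g lt]
      computes_above[of p k g xs, folded gt_def] computes_len_keyed[of k g gt]
    consider "\<not> length lt \<le> j" | "length lt \<le> j" "?n - length gt \<le> j"
      | "length lt \<le> j" "\<not> ?n - length gt \<le> j" by blast
    then show ?thesis
    proof cases
      case 1
      then have below: "computes 9 [keyed k g lt, VNum (real j)] (5000 * length lt) (VNum (sort (map k lt) ! j))"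
        using split False by (intro less.hyps) auto
      show ?thesis
        unfolding computes_def wp_bodies nth
        by (rule computesE[OF calls(1)], rule computesE[OF calls(2)],
            rule computesE[OF calls(3)], rule computesE[OF calls(4)],
            rule computesE[OF calls(5)], rule computesE[OF calls(6)],
            rule computesE[OF below])
          (use False 1 split m in \<open>simp add: select_body_def wp_simps\<close>)
    next
      case 2
      have "length gt \<le> ?n" by (simp add: gt_def)
      then have j: "real (j - (?n - length gt)) = real j - (real ?n - real (length gt))"
        using 2 by (simp add: of_nat_diff)
      have "computes 9 [keyed k g gt, VNum (real (j - (?n - length gt)))]
          (5000 * length gt) (VNum (sort (map k gt) ! (j - (?n - length gt))))"
        using split False less.prems 2 by (intro less.hyps) auto
      note above = this[unfolded j]
      have "real ?n - real (length gt) \<le> real j" using 2 by linarith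
      then show ?thesis
        unfolding computes_def wp_bodies nth
        by (rule_tac computesE[OF calls(1)], rule_tac computesE[OF calls(2)],
            rule_tac computesE[OF calls(3)], rule_tac computesE[OF calls(4)],
            rule_tac computesE[OF calls(5)], rule_tac computesE[OF calls(6)],
            rule_tac computesE[OF calls(7)], rule_tac computesE[OF calls(8)],
            rule_tac computesE[OF above])
          (use False 2 split m in \<open>simp add: select_body_def wp_simps\<close>)
    next
      case 3
      then have "\<not> real ?n - real (length gt) \<le> real j" by linarith
      then show ?thesis
        unfolding computes_def wp_bodies nth
        by (rule_tac computesE[OF calls(1)], rule_tac computesE[OF calls(2)],
            rule_tac computesE[OF calls(3)], rule_tac computesE[OF calls(4)],
            rule_tac computesE[OF calls(5)], rule_tac computesE[OF calls(6)],
            rule_tac computesE[OF calls(7)], rule_tac computesE[OF calls(8)])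
          (use False 3 split m in \<open>simp add: select_body_def wp_simps\<close>)
    qed
  qed
qed

end


section \<open>Prune and search\<close>

lemma hinges_Nil: "hinges m z [] = 0"
  by (simp add: hinges_def)

lemma hinges_Cons: "hinges m z (q # ps) = (if fst q \<le> m then snd q * (z - fst q) else 0) + hinges m z ps"
  by (simp add: hinges_def split_beta)

lemma hinges_append: "hinges m z (ps @ qs) = hinges m z ps + hinges m z qs"
  by (simp add: hinges_def)

lemmas hinges_simps = hinges_Nil hinges_Cons hinges_append

lemma hinges_below:
  "t \<le> m \<Longrightarrow> hinges t t (filter (\<lambda>q. fst q < m) ps) = hinges t t ps"
  by (induction ps) (auto simp: hinges_simps)

lemma hinges_above:
  "m \<le> t \<Longrightarrow> hinges t t ps = (hinges m 1 ps - hinges m 0 ps) * t + hinges m 0 ps +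
    hinges t t (filter (\<lambda>q. m < fst q) ps)"
  by (induction ps) (auto simp: hinges_simps algebra_simps)

context machine
begin

text \<open>
  \<open>S\<close> is the set of candidates that the search has not yet excluded: on it the remaining hinge
  points describe \<open>\<psi>\<close>. If \<open>\<psi>\<close> is constant there, any tracked point \<open>h\<close> of \<open>S\<close> is a root.
\<close>

lemma computes_search:
  fixes \<psi> :: "real \<Rightarrow> real"
  assumes "mono \<psi>" "\<psi> t0 = 0" "t0 \<in> S" "h \<in> S" "fst ` set ps \<subseteq> S"
    and "\<And>t. t \<in> S \<Longrightarrow> \<psi> t = s * t + hinges t t ps - r"
  shows "\<exists>t. \<psi> t = 0 \<and> computes 11 [VNum r, VNum s, VNum h, keyed fst (VNum \<circ> snd) ps]
    (11000 * length ps + 20) (VNum t)"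
  using assms(2-)
proof (induction "length ps" arbitrary: ps S s r h t0 rule: less_induct)
  case less
  show ?case
  proof (cases "ps = []")
    case True
    have r: "s * t = r + \<psi> t" if "t \<in> S" for t
      using less.prems(5)[OF that] True by (simp add: hinges_simps)
    define t where "t = (if s = 0 then h else r / s)"
    \<comment> \<open>For \<open>s \<noteq> 0\<close> the known root \<open>t0\<close> equals
      \<open>r / s\<close>. For \<open>s = 0\<close> it forces \<open>r = 0\<close>, so \<psi>
      vanishes on all of \<open>S\<close>, in particular at \<open>h\<close>.\<close>
    have "\<psi> t = 0"
      using r[OF \<open>t0 \<in> S\<close>] r[OF \<open>h \<in> S\<close>] \<open>\<psi> t0 = 0\<close> by (auto simp: t_def)
    moreover have "computes 11 [VNum r, VNum s, VNum h, keyed fst (VNum \<circ> snd) ps]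
        (11000 * length ps + 20) (VNum t)"
      unfolding computes_def wp_bodies True by (simp add: search_body_def wp_simps t_def)
    ultimately show ?thesis by blast
  next
    case False
    let ?n = "length ps"
    define j where "j = ?n div 2"
    define m where "m = sort (map fst ps) ! j"
    define lt where "lt = filter (\<lambda>q. fst q < m) ps"
    define gt where "gt = filter (\<lambda>q. m < fst q) ps"
    have j: "j < ?n" "2 * j \<le> ?n" "?n \<le> 2 * j + 1"
      using False by (auto simp: j_def)
    have "m \<in> set (sort (map fst ps))"
      unfolding m_def using j by (intro nth_mem) simp
    then have "m \<in> S" using less.prems(4) by auto
    have "?n - j \<le> length (filter (\<lambda>q. m \<le> fst q) ps)" "j < length (filter (\<lambda>q. fst q \<le> m) ps)"
      unfolding m_def using length_filter_nth_sort[OF j(1)] by blast+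
    \<comment> \<open>The 11000 per point pay 5000 for selecting the median, 5500 for the recursive
      call on half of the points and 500 for the other passes.\<close>
    then have half: "2 * length lt \<le> ?n" "2 * length gt \<le> ?n"
      using length_filter_trichotomy(1)[of fst m ps] length_filter_trichotomy(2)[of m fst ps] j(2,3)
      unfolding lt_def gt_def by linarith+
    have n: "0 < ?n" using False by simp
    have shorter: "length (filter (\<lambda>q. fst q < m) ps) < ?n" "length (filter (\<lambda>q. m < fst q) ps) < ?n"
      using half n unfolding lt_def gt_def by linarith+
    note calls = computes_half_keyed[of fst "VNum \<circ> snd" ps, folded j_def]
      computes_select[OF j(1), of fst "VNum \<circ> snd", folded m_def]
      computes_hinges[of m m ps]
    show ?thesis
    proof (cases "r \<le> s * m + hinges m m ps")
      case le: True
      then have "0 \<le> \<psi> m" using less.prems(5)[OF \<open>m \<in> S\<close>] by simp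
      \<comment> \<open>If \<open>m < t0\<close>, then
        \<open>0 \<le> \<psi> m \<le> \<psi> t0 = 0\<close>, so \<open>m\<close> itself is a
        root.\<close>
      then have "\<exists>t\<in>S \<inter> {..m}. \<psi> t = 0"
        using less.prems(1,2) \<open>m \<in> S\<close> monoD[OF \<open>mono \<psi>\<close>, of m t0] by (cases "t0 \<le> m") force+
      then obtain t1 where "\<psi> t1 = 0" "t1 \<in> S \<inter> {..m}" by blast
      then have "\<exists>t. \<psi> t = 0 \<and> computes 11 [VNum r, VNum s, VNum m, keyed fst (VNum \<circ> snd) lt]
          (11000 * length lt + 20) (VNum t)"
        using less.prems(4,5) \<open>m \<in> S\<close> shorter(1)
        by (intro less.hyps[of _ t1 "S \<inter> {..m}"]) (auto simp: lt_def hinges_below)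
      then obtain t where t: "\<psi> t = 0"
        and IH: "computes 11 [VNum r, VNum s, VNum m, keyed fst (VNum \<circ> snd) lt]
          (11000 * length lt + 20) (VNum t)" by blast
      have "computes 11 [VNum r, VNum s, VNum h, keyed fst (VNum \<circ> snd) ps] (11000 * ?n + 20) (VNum t)"
        unfolding computes_def wp_bodies
        by (rule computesE[OF calls(1)], rule computesE[OF calls(2)], rule computesE[OF calls(3)],
            rule computesE[OF computes_below[of m fst "VNum \<circ> snd" ps, folded lt_def]],
            rule computesE[OF IH])
          (use n half False le in \<open>cases ps; simp add: search_body_def wp_simps\<close>)
      with t show ?thesis by blast
    next
      case le: False
      then have "\<psi> m < 0" using less.prems(5)[OF \<open>m \<in> S\<close>] by simp
      then have "m \<le> t0" using less.prems(1) monoD[OF \<open>mono \<psi>\<close>, of t0 m] by force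
      define c where "c = hinges m 0 ps"
      define s' where "s' = s + (hinges m 1 ps - c)"
      have "\<psi> t = s' * t + hinges t t gt - (r - c)" if "t \<in> S" "m \<le> t" for t
        using less.prems(5)[OF that(1)] hinges_above[OF that(2), of ps]
        by (simp add: gt_def s'_def c_def algebra_simps)
      then have "\<exists>t. \<psi> t = 0 \<and> computes 11 [VNum (r - c), VNum s', VNum m, keyed fst (VNum \<circ> snd) gt]
          (11000 * length gt + 20) (VNum t)"
        using less.prems \<open>m \<in> S\<close> \<open>m \<le> t0\<close> shorter(2)
        by (intro less.hyps[of _ t0 "S \<inter> {m..}"])
          (auto simp: gt_def)
      then obtain t where t: "\<psi> t = 0"
        and IH: "computes 11 [VNum (r - c), VNum s', VNum m, keyed fst (VNum \<circ> snd) gt]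
          (11000 * length gt + 20) (VNum t)" by blast
      have "computes 11 [VNum r, VNum s, VNum h, keyed fst (VNum \<circ> snd) ps] (11000 * ?n + 20) (VNum t)"
        unfolding computes_def wp_bodies
        by (rule computesE[OF calls(1)], rule computesE[OF calls(2)], rule computesE[OF calls(3)],
            rule computesE[OF computes_hinges[of m 0 ps, folded c_def]],
            rule computesE[OF computes_hinges[of m 1 ps]],
            rule computesE[OF computes_above[of m fst "VNum \<circ> snd" ps, folded gt_def]],
            rule computesE[OF IH[unfolded s'_def]])
          (use n half False le in \<open>cases ps; simp add: search_body_def wp_simps\<close>)
      with t show ?thesis by blast
    qed
  qed
qed

end

section \<open>The clipped sum as a piecewise linear function\<close>

lemma clip_eq: "l \<le> u \<Longrightarrow> clip l u v = max l (min u v)"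
  by (auto simp: clip_def)

text \<open>The two points are where \<open>a * (t - b)\<close> enters and leaves the box; the slope
  in \<open>t\<close> rises by \<open>a\<close> at the first and falls by \<open>a\<close> at the
  second.\<close>

lemma clip_hinges:
  assumes "0 < a" "l \<le> u"
  shows "clip l u (a * (t - b)) = l + hinges t t [(l / a + b, a), (u / a + b, - a)]"
  using assms by (auto simp: clip_def hinges_simps field_simps)

lemma clip_bounds: "l \<le> u \<Longrightarrow> l \<le> clip l u v" "l \<le> u \<Longrightarrow> clip l u v \<le> u"
  by (auto simp: clip_def)

lemma sum_clip_hinges:
  assumes "\<forall>i\<in>set is. 0 < a i \<and> l i \<le> u i"
  shows "(\<Sum>i\<leftarrow>is. clip (l i) (u i) (a i * (t - b i))) = (\<Sum>i\<leftarrow>is. l i) + hinges t t (points a b l u is)"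
  using assms
proof (induction "is")
  case (Cons i "is")
  then have "0 < a i" "l i \<le> u i" by auto
  from clip_hinges[OF this] Cons show ?case by (simp add: points_def hinges_append hinges_simps)
qed (simp add: points_def hinges_simps)

lemma mono_sum_clip:
  assumes "\<forall>i\<in>set is. 0 < a i \<and> l i \<le> u i"
  shows "mono (\<lambda>t. \<Sum>i\<leftarrow>is. clip (l i) (u i) (a i * (t - b i)))"
proof (intro monoI sum_list_mono)
  fix t t' :: real and i assume "t \<le> t'" "i \<in> set is"
  with assms have "a i * (t - b i) \<le> a i * (t' - b i)" "l i \<le> u i" by auto
  then show "clip (l i) (u i) (a i * (t - b i)) \<le> clip (l i) (u i) (a i * (t' - b i))"
    by (simp add: clip_eq)
qed

text \<open>Left of all breakpoints every coordinate is at its lower bound, right of them at its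
  upper bound; intermediate values do the rest. This supplies the root that the search
  presupposes.\<close>

lemma ex_sum_clip:
  fixes a b l u :: "nat \<Rightarrow> real"
  assumes "\<forall>i\<in>set is. 0 < a i \<and> l i \<le> u i"
    and "(\<Sum>i\<leftarrow>is. l i) \<le> r" "r \<le> (\<Sum>i\<leftarrow>is. u i)"
  shows "\<exists>t. (\<Sum>i\<leftarrow>is. clip (l i) (u i) (a i * (t - b i))) = r"
proof -
  let ?\<phi> = "\<lambda>t. \<Sum>i\<leftarrow>is. clip (l i) (u i) (a i * (t - b i))"
  obtain c where c: "\<forall>i\<in>set is. c \<le> l i / a i + b i"
    using bdd_below_finite[of "(\<lambda>i. l i / a i + b i) ` set is"] by (auto simp: bdd_below_def)
  obtain d where d: "\<forall>i\<in>set is. u i / a i + b i \<le> d"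
    using bdd_above_finite[of "(\<lambda>i. u i / a i + b i) ` set is"] by (auto simp: bdd_above_def)
  have "clip (l i) (u i) (a i * (c - b i)) = l i" if "i \<in> set is" for i
  proof -
    have "0 < a i" "c \<le> l i / a i + b i" using that assms(1) c by auto
    then have "a i * (c - b i) \<le> l i" by (simp add: field_simps)
    then show ?thesis by (simp add: clip_def)
  qed
  then have lo: "?\<phi> c = (\<Sum>i\<leftarrow>is. l i)" by (simp cong: map_cong)
  have "clip (l i) (u i) (a i * (d - b i)) = u i" if "i \<in> set is" for i
  proof -
    have "0 < a i" "u i / a i + b i \<le> d" "l i \<le> u i" using that assms(1) d by auto
    moreover from this have "u i \<le> a i * (d - b i)" by (simp add: field_simps)
    ultimately show ?thesis by (simp add: clip_def)
  qed
  then have hi: "?\<phi> d = (\<Sum>i\<leftarrow>is. u i)" by (simp cong: map_cong)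
  have "continuous_on UNIV (\<lambda>t. \<Sum>i\<leftarrow>is. max (l i) (min (u i) (a i * (t - b i))))"
    by (induction "is") (auto intro!: continuous_intros)
  moreover have "?\<phi> t = (\<Sum>i\<leftarrow>is. max (l i) (min (u i) (a i * (t - b i))))" for t
    using assms(1) by (simp add: clip_eq cong: map_cong)
  ultimately have cont: "continuous_on UNIV ?\<phi>" by simp
  have "connected (range ?\<phi>)"
    using connected_continuous_image[OF cont connected_UNIV] .
  from connected_contains_Icc[OF this rangeI rangeI, of c d]
  have "r \<in> range ?\<phi>"
    using assms(2,3) unfolding lo hi by (meson atLeastAtMost_iff subsetD)
  then show ?thesis by auto
qed

context machine
begin

text \<open>Subtracting the lower bounds leaves pure hinges, so the search starts without an affine
  part, with every real as a candidate and an arbitrary \<open>h = 0\<close>. Two hinges per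
  variable make up 22000 of the 23000.\<close>

lemma computes_relax:
  fixes a b l u :: "nat \<Rightarrow> real"
  assumes "\<forall>i\<in>set is. 0 < a i \<and> l i \<le> u i"
    and "(\<Sum>i\<leftarrow>is. l i) \<le> r" "r \<le> (\<Sum>i\<leftarrow>is. u i)"
  shows "\<exists>t. (\<Sum>i\<leftarrow>is. clip (l i) (u i) (a i * (t - b i))) = r \<and>
    computes 1 [VNum r, encode (map a is), encode (map b is), encode (map l is), encode (map u is)]
      (23000 * length is + 100) (encode (map (\<lambda>i. clip (l i) (u i) (a i * (t - b i))) is))"
proof -
  let ?\<phi> = "\<lambda>t. \<Sum>i\<leftarrow>is. clip (l i) (u i) (a i * (t - b i))"
  let ?ps = "points a b l u is"
  obtain t0 where t0: "?\<phi> t0 = r" using ex_sum_clip[OF assms] by blast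
  have "mono (\<lambda>t. ?\<phi> t - r)"
    using mono_sum_clip[OF assms(1)] by (simp add: mono_def)
  then obtain t where t: "?\<phi> t = r"
    and search: "computes 11 [VNum (r - (\<Sum>i\<leftarrow>is. l i)), VNum 0, VNum 0, keyed fst (VNum \<circ> snd) ?ps]
      (11000 * length ?ps + 20) (VNum t)"
    using computes_search[of "\<lambda>t. ?\<phi> t - r" t0 UNIV 0 ?ps 0 "r - (\<Sum>i\<leftarrow>is. l i)"] t0
      sum_clip_hinges[OF assms(1)] by auto
  have len: "length ?ps = 2 * length is"
    by (induction "is") (auto simp: points_def)
  have a: "\<forall>i\<in>set is. a i \<noteq> 0" using assms(1) by auto
  have "computes 1 [VNum r, encode (map a is), encode (map b is), encode (map l is), encode (map u is)]
      (23000 * length is + 100) (encode (map (\<lambda>i. clip (l i) (u i) (a i * (t - b i))) is))"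
    unfolding computes_def wp_bodies
    by (rule computesE[OF computes_sum[of "map l is"]], rule computesE[OF computes_points[OF a, of b l u]],
        rule computesE[OF search], rule computesE[OF computes_assign[of t a "is" b l u]])
      (simp add: relax_body_def wp_simps len)
  with t show ?thesis by blast
qed

section \<open>Listing unit steps and distributing a quota of ties\<close>

lemma computes_units:
  assumes "\<forall>i\<in>set is. a i \<noteq> 0" "\<forall>i\<in>set is. hi i = lo i + real (m i)"
  shows "computes 19 [encode (map a is), encode (map b is), encode (map lo is), encode (map hi is)]
    (40 * (\<Sum>i\<leftarrow>is. m i) + 40 * length is + 3)
    (lst (map (\<lambda>i. keyed (\<lambda>s. s) (\<lambda>_. VNil)
      (map (\<lambda>r. slope f (a i) (b i) (lo i + real r)) [0..<m i])) is))"
  using assms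
proof (induction "is")
  case (Cons i "is")
  then have IH: "computes 19 [encode (map a is), encode (map b is), encode (map lo is), encode (map hi is)]
    (40 * (\<Sum>i\<leftarrow>is. m i) + 40 * length is + 3)
    (lst (map (\<lambda>i. keyed (\<lambda>s. s) (\<lambda>_. VNil)
      (map (\<lambda>r. slope f (a i) (b i) (lo i + real r)) [0..<m i])) is))" by simp
  have i: "a i \<noteq> 0" "hi i = lo i + real (m i)" using Cons.prems by auto
  show ?case
    unfolding computes_def wp_bodies
    by (rule computesE[OF IH], rule computesE[OF computes_slopes[OF i(1), of "b i" "lo i" "m i"]])
      (simp add: units_body_def wp_simps i(2))
qed (unfold computes_def wp_bodies, simp_all add: units_body_def wp_simps)

text \<open>Which steps of slope exactly \<open>q\<close> are taken is irrelevant for optimality, so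
  the quota \<rho> of ties is spent greedily from the left. Only the range of each count and the
  total are recorded, the total provided that there are enough ties.\<close>

lemma computes_fill:
  fixes us :: "nat \<Rightarrow> real list" and q :: real
  defines "lt \<equiv> \<lambda>i. length (filter (\<lambda>s. s < q) (us i))"
    and "eq \<equiv> \<lambda>i. length (filter (\<lambda>s. s = q) (us i))"
  assumes "distinct is"
  shows "\<exists>c. computes 22
      [VNum q, VNum (real \<rho>), encode (map lo is), lst (map (\<lambda>i. keyed (\<lambda>s. s) (\<lambda>_. VNil) (us i)) is)]
      (70 * (\<Sum>i\<leftarrow>is. length (us i)) + 100 * length is + 3)
      (encode (map (\<lambda>i. lo i + real (c i)) is)) \<and>
    (\<forall>i\<in>set is. lt i \<le> c i \<and> c i \<le> lt i + eq i) \<and>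
    (\<rho> \<le> (\<Sum>i\<leftarrow>is. eq i) \<longrightarrow> (\<Sum>i\<leftarrow>is. c i) = (\<Sum>i\<leftarrow>is. lt i) + \<rho>)"
  using assms(3)
proof (induction "is" arbitrary: \<rho>)
  case Nil
  show ?case unfolding computes_def wp_bodies by (simp add: fill_body_def wp_simps)
next
  case (Cons i "is")
  let ?k = "\<lambda>s. s :: real" and ?g = "\<lambda>_ :: real. VNil"
  define d where "d = min \<rho> (eq i)"
  obtain c where c: "computes 22
      [VNum q, VNum (real (\<rho> - d)), encode (map lo is), lst (map (\<lambda>i. keyed ?k ?g (us i)) is)]
      (70 * (\<Sum>i\<leftarrow>is. length (us i)) + 100 * length is + 3)
      (encode (map (\<lambda>i. lo i + real (c i)) is))"
    "\<forall>i\<in>set is. lt i \<le> c i \<and> c i \<le> lt i + eq i"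
    "\<rho> - d \<le> (\<Sum>i\<leftarrow>is. eq i) \<longrightarrow> (\<Sum>i\<leftarrow>is. c i) = (\<Sum>i\<leftarrow>is. lt i) + (\<rho> - d)"
    using Cons.IH[of "\<rho> - d"] Cons.prems by auto
  have eq: "real (length (us i)) - real (length (filter (\<lambda>s. q < s) (us i))) - real (lt i) = real (eq i)"
    using length_filter_trichotomy(3)[of ?k q "us i"] by (simp add: lt_def eq_def flip: of_nat_add)
  have d: "real d = (if eq i \<le> \<rho> then real (eq i) else real \<rho>)"
    "real (\<rho> - d) = (if eq i \<le> \<rho> then real \<rho> - real (eq i) else 0)"
    by (auto simp: d_def min_def of_nat_diff)
  have len: "length (filter (\<lambda>s. s < q) (us i)) \<le> length (us i)"
    "length (filter (\<lambda>s. q < s) (us i)) \<le> length (us i)" by simp_all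
  \<comment> \<open>By distinctness \<open>i\<close> does not recur in the tail, so the update
    preserves the counts from the induction hypothesis.\<close>
  define c' where "c' = c(i := lt i + d)"
  have c': "map (\<lambda>i. lo i + real (c' i)) is = map (\<lambda>i. lo i + real (c i)) is"
    "map c' is = map c is"
    using Cons.prems by (auto simp: c'_def)
  have "computes 22 [VNum q, VNum (real \<rho>), encode (map lo (i # is)),
        lst (map (\<lambda>i. keyed ?k ?g (us i)) (i # is))]
      (70 * (\<Sum>i\<leftarrow>i # is. length (us i)) + 100 * length (i # is) + 3)
      (encode (map (\<lambda>i. lo i + real (c' i)) (i # is)))"
    unfolding computes_def wp_bodies list.map c'
    by (rule computesE[OF computes_below[of q ?k ?g "us i"]],
        rule computesE[OF computes_len_keyed[of ?k ?g "filter (\<lambda>s. s < q) (us i)", folded lt_def]],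
        rule computesE[OF computes_len_keyed[of ?k ?g "us i"]],
        rule computesE[OF computes_above[of q ?k ?g "us i"]],
        rule computesE[OF computes_len_keyed[of ?k ?g "filter (\<lambda>s. q < s) (us i)"]],
        rule computesE[OF c(1)[unfolded d(2)]])
      (use eq len d in \<open>cases "eq i \<le> \<rho>"; simp add: fill_body_def wp_simps c'_def lt_def\<close>)
  moreover have "\<forall>j\<in>set (i # is). lt j \<le> c' j \<and> c' j \<le> lt j + eq j"
    using c(2) by (auto simp: c'_def d_def)
  moreover have "(\<Sum>j\<leftarrow>i # is. c' j) = (\<Sum>j\<leftarrow>i # is. lt j) + \<rho>" if "\<rho> \<le> (\<Sum>j\<leftarrow>i # is. eq j)"
    using that c(3) by (simp add: c'(2)) (auto simp: c'_def d_def)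
  ultimately show ?case by blast
qed

end


section \<open>Optimality conditions\<close>

lemma convex_adjacent_slopes:
  fixes f :: "real \<Rightarrow> real"
  assumes "convex_on UNIV f" "x < y" "y < z"
  shows "(f y - f x) / (y - x) \<le> (f z - f y) / (z - y)"
proof -
  have "(f x - f y) / (x - y) \<le> (f y - f z) / (y - z)"
    using convex_on_slope_le[OF assms(1) UNIV_I UNIV_I assms(2,3)] by linarith
  then show ?thesis by (metis minus_diff_eq minus_divide_divide)
qed

lemma convex_slopes_le:
  fixes f :: "real \<Rightarrow> real"
  assumes "convex_on UNIV f" "x < y" "y \<le> x'" "x' < y'"
  shows "(f y - f x) / (y - x) \<le> (f y' - f x') / (y' - x')"
proof (cases "y = x'")
  case False
  then show ?thesis
    using convex_adjacent_slopes[OF assms(1), of x y x'] convex_adjacent_slopes[OF assms(1), of y x' y'] assms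
    by linarith
qed (use convex_adjacent_slopes[OF assms(1)] assms in auto)

text \<open>A unit step covers an interval of length \<open>1 / a\<close>, so the factor
  \<open>a\<close> makes its cost a chord slope of \<open>f\<close>. This is why steps of different
  variables are comparable.\<close>

lemma slope_eq: "0 < a \<Longrightarrow> slope f a b x =
    (f ((x + 1) / a + b) - f (x / a + b)) / (((x + 1) / a + b) - (x / a + b))"
  by (simp add: slope_def field_simps)

lemma slope_le:
  assumes "convex_on UNIV f" "0 < a" "0 < a'" "(x + 1) / a + b \<le> x' / a' + b'"
  shows "slope f a b x \<le> slope f a' b' x'"
  unfolding slope_eq[OF assms(2)] slope_eq[OF assms(3)]
  by (rule convex_slopes_le[OF assms(1) _ assms(4)]) (use assms in \<open>auto simp: divide_strict_right_mono\<close>)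

text \<open>Take for \<open>p\<close> the infimum of the chord slopes to the right of
  \<open>t\<close>. Chords right of \<open>t\<close> have slope at least \<open>p\<close>, those
  left of \<open>t\<close> at most \<open>p\<close>; for moves away from \<open>t\<close> both give
  the same inequality.\<close>

lemma convex_subgradient:
  fixes f :: "real \<Rightarrow> real"
  assumes f: "convex_on UNIV f"
  obtains p where "\<And>v w. t \<le> v \<and> v \<le> w \<or> w \<le> v \<and> v \<le> t \<Longrightarrow> p * (w - v) \<le> f w - f v"
    and "\<And>w. p * (w - t) \<le> f w - f t"
proof -
  define p where "p = Inf ((\<lambda>x. (f t - f x) / (t - x)) ` ({t<..} \<inter> UNIV))"
  have p: "f t + p * (w - t) \<le> f w" for w
    unfolding p_def by (rule convex_le_Inf_differential[OF f]) auto
  have 1: "p * (w - v) \<le> f w - f v" if "t \<le> v" "v \<le> w" for v w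
  proof (cases "t < v \<and> v < w")
    case True
    have "p \<le> (f v - f t) / (v - t)" using p[of v] True by (simp add: field_simps)
    also have "\<dots> \<le> (f w - f v) / (w - v)" using convex_adjacent_slopes[OF f] True by blast
    finally show ?thesis using True by (simp add: field_simps)
  qed (use that p[of w] in auto)
  have 2: "p * (w - v) \<le> f w - f v" if "w \<le> v" "v \<le> t" for v w
  proof (cases "w < v \<and> v < t")
    case True
    then have "(f v - f w) / (v - w) \<le> (f t - f v) / (t - v)" using convex_adjacent_slopes[OF f] by blast
    also have "\<dots> \<le> p" using p[of v] True by (simp add: field_simps)
    finally show ?thesis using True by (simp add: field_simps)
  qed (use that p[of w] in auto)
  show thesis using that[of p] 1 2 p by (metis add.commute le_diff_eq)
qed

text \<open>\<open>p\<close> is a Lagrange multiplier of the sum constraint: feasible points share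
  the sum \<open>R\<close>, so the left-hand sides add up to 0.\<close>

lemma optimal_if_supported:
  assumes "feasible \<gamma> n R l u x"
    and "\<And>y i. feasible \<gamma> n R l u y \<Longrightarrow> i \<in> {1..n} \<Longrightarrow>
      p * (y i - x i) \<le> a i * f (y i / a i + b i) - a i * f (x i / a i + b i)"
  shows "optimal \<gamma> n a b f R l u x"
  unfolding optimal_def
proof (intro conjI allI impI)
  fix y assume y: "feasible \<gamma> n R l u y"
  have "0 = p * ((\<Sum>i=1..n. y i) - (\<Sum>i=1..n. x i))"
    using y assms(1) by (simp add: feasible_def)
  also have "\<dots> = (\<Sum>i=1..n. p * (y i - x i))" by (simp only: sum_subtractf flip: sum_distrib_left)
  also have "\<dots> \<le> (\<Sum>i=1..n. a i * f (y i / a i + b i) - a i * f (x i / a i + b i))"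
    using assms(2)[OF y] by (intro sum_mono) auto
  also have "\<dots> = objective n a b f y - objective n a b f x"
    by (simp add: objective_def sum_subtractf)
  finally show "objective n a b f x \<le> objective n a b f y" by simp
qed (rule assms(1))

lemma optimal_continuous:
  assumes f: "convex_on UNIV f"
    and "\<forall>i\<in>{1..n}. 0 < a i" "\<forall>i\<in>{1..n}. l i \<le> u i"
    and "(\<Sum>i=1..n. clip (l i) (u i) (a i * (t - b i))) = R"
  shows "optimal Cont n a b f R l u (\<lambda>i. clip (l i) (u i) (a i * (t - b i)))"
proof -
  obtain p where p: "\<And>v w. t \<le> v \<and> v \<le> w \<or> w \<le> v \<and> v \<le> t \<Longrightarrow> p * (w - v) \<le> f w - f v"
    "\<And>w. p * (w - t) \<le> f w - f t"
    using convex_subgradient[OF f, of t] by metis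
  show ?thesis
  proof (rule optimal_if_supported)
    show "feasible Cont n R l u (\<lambda>i. clip (l i) (u i) (a i * (t - b i)))"
      using assms by (auto simp: feasible_def clip_bounds)
  next
    fix y i assume "feasible Cont n R l u y" and i: "i \<in> {1..n}"
    then have y: "l i \<le> y i" "y i \<le> u i" by (auto simp: feasible_def)
    have a: "0 < a i" using assms(2) i by auto
    define x where "x = clip (l i) (u i) (a i * (t - b i))"
    let ?v = "x / a i + b i" and ?w = "y i / a i + b i"
    have "p * (?w - ?v) \<le> f ?w - f ?v"
    proof (cases "x = a i * (t - b i)")
      case True
      then have "?v = t" using a by simp
      then show ?thesis using p(2) by metis
    next
      case False
      \<comment> \<open>A clipped coordinate lies at the bound that faces the unclipped value, so
        every feasible \<open>y i\<close> lies on its far side.\<close>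
      then have "x = l i \<and> a i * (t - b i) \<le> x \<or> x = u i \<and> x \<le> a i * (t - b i)"
        by (auto simp: x_def clip_def split: if_splits)
      then have "a i * (t - b i) \<le> x \<and> x \<le> y i \<or> y i \<le> x \<and> x \<le> a i * (t - b i)"
        using y by auto
      then have "t \<le> ?v \<and> ?v \<le> ?w \<or> ?w \<le> ?v \<and> ?v \<le> t"
        using a by (auto simp: field_simps)
      then show ?thesis by (rule p(1))
    qed
    then have "a i * (p * (?w - ?v)) \<le> a i * (f ?w - f ?v)" using a by simp
    moreover have "a i * (p * (?w - ?v)) = p * (y i - x)" using a by (simp add: field_simps)
    ultimately show "p * (y i - x) \<le> a i * f ?w - a i * f ?v" by (simp add: right_diff_distrib)
  qed
qed

text \<open>The difference telescopes into the unit-step slopes between \<open>z\<close> and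
  \<open>y\<close>; inductions upwards from \<open>z\<close> and from \<open>y\<close> cover the two
  directions.\<close>

lemma integer_supported:
  fixes f :: "real \<Rightarrow> real" and a b q :: real and z y :: int
  assumes "\<And>j. z \<le> j \<Longrightarrow> j < y \<Longrightarrow> q \<le> slope f a b j"
    and "\<And>j. y \<le> j \<Longrightarrow> j < z \<Longrightarrow> slope f a b j \<le> q"
  shows "q * (of_int y - of_int z) \<le> a * f (y / a + b) - a * f (z / a + b)"
proof -
  define G where "G = (\<lambda>j :: int. a * f (j / a + b))"
  have G: "slope f a b j = G (j + 1) - G j" for j
    by (simp add: slope_def G_def right_diff_distrib)
  have up: "q * (y - z) \<le> G y - G z" if "z \<le> y" "\<forall>j. z \<le> j \<and> j < y \<longrightarrow> q \<le> G (j + 1) - G j" for y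
    using that
  proof (induction y rule: int_ge_induct)
    case (step y)
    then have "q * (y - z) \<le> G y - G z" "q \<le> G (y + 1) - G y" by auto
    then show ?case by (simp add: algebra_simps)
  qed simp
  have down: "G z - G y \<le> q * (z - y)" if "y \<le> z" "\<forall>j. y \<le> j \<and> j < z \<longrightarrow> G (j + 1) - G j \<le> q" for z
    using that
  proof (induction z rule: int_ge_induct)
    case (step z)
    then have "G z - G y \<le> q * (z - y)" "G (z + 1) - G z \<le> q" by auto
    then show ?case by (simp add: algebra_simps)
  qed simp
  have "q * (y - z) \<le> G y - G z"
  proof (cases "z \<le> y")
    case True
    with up assms(1) show ?thesis by (simp add: G)
  next
    case False
    with down[of z] assms(2) show ?thesis by (simp add: G algebra_simps)
  qed
  then show ?thesis by (simp add: G_def)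
qed

text \<open>Here the multiplier is a threshold \<open>q\<close> between the steps taken and those
  left out. Only steps inside the box are tested, since feasible points use no others.\<close>

lemma optimal_integer_threshold:
  fixes z :: "nat \<Rightarrow> int"
  assumes "feasible Intg n R l u z"
    and "\<And>i j. i \<in> {1..n} \<Longrightarrow> z i \<le> j \<Longrightarrow> j + 1 \<le> u i \<Longrightarrow> q \<le> slope f (a i) (b i) (of_int j)"
    and "\<And>i j. i \<in> {1..n} \<Longrightarrow> l i \<le> j \<Longrightarrow> j < z i \<Longrightarrow> slope f (a i) (b i) (of_int j) \<le> q"
  shows "optimal Intg n a b f R l u z"
proof (rule optimal_if_supported[OF assms(1), where p = q])
  fix y i assume "feasible Intg n R l u y" and i: "i \<in> {1..n}"
  then have y: "l i \<le> y i" "y i \<le> u i" and "y i \<in> \<int>" by (auto simp: feasible_def)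
  then obtain y' :: int where y': "y i = y'" by (elim Ints_cases)
  show "q * (y i - z i) \<le> a i * f (y i / a i + b i) - a i * f (z i / a i + b i)"
    unfolding y'
  proof (rule integer_supported)
    fix j assume "z i \<le> j" "j < y'"
    then show "q \<le> slope f (a i) (b i) j" using y y' assms(2)[OF i] by (intro assms(2)[OF i]) linarith+
  next
    fix j assume "y' \<le> j" "j < z i"
    then show "slope f (a i) (b i) j \<le> q" using y y' by (intro assms(3)[OF i]) linarith+
  qed
qed

section \<open>Order statistics by counting\<close>

lemma nth_sort_le:
  fixes xs :: "real list"
  assumes "j < length (filter (\<lambda>s. s \<le> \<sigma>) xs)"
  shows "sort xs ! j \<le> \<sigma>"
proof (rule ccontr)
  assume less: "\<not> sort xs ! j \<le> \<sigma>"
  have j: "j < length xs" using assms length_filter_le[of "\<lambda>s. s \<le> \<sigma>" xs] by linarith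
  have "length xs - j \<le> length (filter (\<lambda>s. sort xs ! j \<le> s) xs)"
    using length_filter_nth_sort(2)[OF j, of "\<lambda>s. s"] by simp
  also have "\<dots> \<le> length (filter (\<lambda>s. \<sigma> < s) xs)"
    using less by (intro length_filter_mono) auto
  finally show False
    using length_filter_trichotomy(2)[of \<sigma> "\<lambda>s. s" xs] assms j by linarith
qed

lemma nth_sort_ge:
  fixes xs :: "real list"
  assumes "length (filter (\<lambda>s. s < \<sigma>) xs) \<le> j" "j < length xs"
  shows "\<sigma> \<le> sort xs ! j"
proof (rule ccontr)
  assume less: "\<not> \<sigma> \<le> sort xs ! j"
  have "j < length (filter (\<lambda>s. s \<le> sort xs ! j) xs)"
    using length_filter_nth_sort(1)[OF assms(2), of "\<lambda>s. s"] by simp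
  also have "\<dots> \<le> length (filter (\<lambda>s. s < \<sigma>) xs)"
    using less by (intro length_filter_mono) auto
  finally show False using assms by linarith
qed

text \<open>In a sorted list the taken elements form a prefix, so its length \<open>c\<close> alone
  decides whether \<open>q\<close> separates them from the rest.\<close>

lemma sorted_nth_threshold:
  fixes xs :: "real list"
  assumes "sorted xs" "r < length xs"
  shows "r < c \<Longrightarrow> c \<le> length (filter (\<lambda>s. s \<le> q) xs) \<Longrightarrow> xs ! r \<le> q"
    and "length (filter (\<lambda>s. s < q) xs) \<le> c \<Longrightarrow> c \<le> r \<Longrightarrow> q \<le> xs ! r"
  using nth_sort_le[of r q xs] nth_sort_ge[of q xs r] assms by (simp_all add: sorted_sort_id)


section \<open>Rounding to the integer case\<close>

lemma feasible_round:
  "feasible Intg n R (\<lambda>i. of_int \<lceil>l i\<rceil>) (\<lambda>i. of_int \<lfloor>u i\<rfloor>) x \<longleftrightarrow> feasible Intg n R l u x"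
proof -
  have "of_int \<lceil>l i\<rceil> \<le> x i \<and> x i \<le> of_int \<lfloor>u i\<rfloor> \<longleftrightarrow> l i \<le> x i \<and> x i \<le> u i" if "x i \<in> \<int>" for i
    using that by (auto simp: ceiling_le_iff le_floor_iff elim!: Ints_cases)
  then show ?thesis by (auto simp: feasible_def)
qed

lemma optimal_round:
  "optimal Intg n a b f R (\<lambda>i. of_int \<lceil>l i\<rceil>) (\<lambda>i. of_int \<lfloor>u i\<rfloor>) x \<longleftrightarrow> optimal Intg n a b f R l u x"
  by (simp add: optimal_def feasible_round)

lemma clip_less_upper: "l \<le> u \<Longrightarrow> clip l u v < u \<Longrightarrow> v \<le> clip l u v"
  by (auto simp: clip_def split: if_splits)

lemma clip_greater_lower: "l \<le> u \<Longrightarrow> l < clip l u v \<Longrightarrow> clip l u v \<le> v"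
  by (auto simp: clip_def split: if_splits)

lemma of_int_sum_nat:
  assumes "\<And>i. i \<in> A \<Longrightarrow> 0 \<le> d i"
  shows "real (\<Sum>i\<in>A. nat (d i)) = (\<Sum>i\<in>A. of_int (d i))"
  using assms by simp

text \<open>
  The intervals \<open>[j / a i + b i, (j + 1) / a i + b i]\<close> of unit steps that end before \<open>t\<close> have
  smaller slopes than those that start after \<open>t\<close>, and likewise for \<open>t'\<close>. By the choice of the sums
  an optimal solution uses all steps before \<open>t\<close> and none after \<open>t'\<close>, and only \<open>O(n)\<close> steps lie
  between.
\<close>

locale rounding =
  fixes f :: "real \<Rightarrow> real" and n :: nat and a b :: "nat \<Rightarrow> real" and l u :: "nat \<Rightarrow> int"
    and R t t' :: real
  assumes convex: "convex_on UNIV f"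
    and pos: "i \<in> {1..n} \<Longrightarrow> 0 < a i"
    and box: "i \<in> {1..n} \<Longrightarrow> l i \<le> u i"
    and R_int: "R \<in> \<int>"
    and R_bounds: "(\<Sum>i=1..n. of_int (l i)) < R" "R \<le> (\<Sum>i=1..n. of_int (u i))"
    and lower_sum: "(\<Sum>i=1..n. clip (l i) (u i) (a i * (t - b i))) = max (R - n) (\<Sum>i=1..n. of_int (l i))"
    and upper_sum: "(\<Sum>i=1..n. clip (l i) (u i) (a i * (t' - b i))) = min (R + n) (\<Sum>i=1..n. of_int (u i))"
begin

definition x :: "nat \<Rightarrow> real" where "x i = clip (l i) (u i) (a i * (t - b i))"
definition y :: "nat \<Rightarrow> real" where "y i = clip (l i) (u i) (a i * (t' - b i))"
definition lo :: "nat \<Rightarrow> int" where "lo i = \<lfloor>x i\<rfloor>"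
definition hi :: "nat \<Rightarrow> int" where "hi i = \<lceil>y i\<rceil>"
definition steps :: "nat \<Rightarrow> real list" where
  "steps i = map (\<lambda>r. slope f (a i) (b i) (lo i + real r)) [0..<nat (hi i - lo i)]"
definition k :: nat where "k = nat \<lfloor>R - (\<Sum>i=1..n. lo i)\<rfloor>"

lemma n_pos: "0 < n"
  using R_bounds by (cases "n = 0") auto

text \<open>The order of \<open>t\<close> and \<open>t'\<close> is not assumed. If
  \<open>t' < t\<close>, monotonicity gives \<open>y \<le> x\<close> in every coordinate while the
  sums are ordered the other way, so all coordinates agree.\<close>

lemma x_le_y:
  assumes "i \<in> {1..n}"
  shows "x i \<le> y i"
proof -
  have le: "clip (l i) (u i) (a i * (s - b i)) \<le> clip (l i) (u i) (a i * (s' - b i))"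
    if "s \<le> s'" "i \<in> {1..n}" for s s' i
  proof -
    have "a i * (s - b i) \<le> a i * (s' - b i)" using that pos[of i] by simp
    then show ?thesis using box[OF that(2)] by (simp add: clip_eq)
  qed
  show ?thesis
  proof (cases "t \<le> t'")
    case True
    with le assms show ?thesis by (simp add: x_def y_def)
  next
    case False
    with le have *: "y j \<le> x j" if "j \<in> {1..n}" for j
      using that by (simp add: x_def y_def)
    have "(\<Sum>i=1..n. x i) \<le> (\<Sum>i=1..n. y i)"
      using R_bounds upper_sum lower_sum by (simp add: x_def y_def)
    moreover have "(\<Sum>i=1..n. y i) \<le> (\<Sum>i=1..n. x i)" using * by (intro sum_mono) auto
    ultimately have "(\<Sum>i=1..n. y i) = (\<Sum>i=1..n. x i)" by simp
    from sum_mono_inv[OF this * assms] show ?thesis by simp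
  qed
qed

lemma range:
  assumes "i \<in> {1..n}"
  shows "l i \<le> x i" "y i \<le> u i" "x i \<le> u i" "l i \<le> y i" "l i \<le> lo i" "lo i \<le> hi i" "hi i \<le> u i"
proof -
  show *: "l i \<le> x i" "y i \<le> u i" "x i \<le> u i" "l i \<le> y i"
    using box[OF assms] by (auto simp: x_def y_def clip_bounds)
  from * show "l i \<le> lo i" "hi i \<le> u i"
    by (auto simp: lo_def hi_def le_floor_iff ceiling_le_iff)
  have "of_int (lo i) \<le> real_of_int (hi i)"
    using x_le_y[OF assms] of_int_floor_le[of "x i"] le_of_int_ceiling[of "y i"]
    unfolding lo_def hi_def by linarith
  then show "lo i \<le> hi i" by simp
qed

text \<open>Each of the \<open>n > 0\<close> coordinates moves by less than 1; a shift of the target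
  sum by \<open>n\<close> therefore outweighs all rounding.\<close>

lemma sum_floor_bounds:
  fixes v :: "nat \<Rightarrow> real"
  shows "(\<Sum>i=1..n. real_of_int \<lfloor>v i\<rfloor>) \<le> (\<Sum>i=1..n. v i)"
    "(\<Sum>i=1..n. v i) < (\<Sum>i=1..n. real_of_int \<lfloor>v i\<rfloor>) + real n"
    "(\<Sum>i=1..n. v i) \<le> (\<Sum>i=1..n. real_of_int \<lceil>v i\<rceil>)"
    "(\<Sum>i=1..n. real_of_int \<lceil>v i\<rceil>) < (\<Sum>i=1..n. v i) + real n"
proof -
  have n: "{1..n} \<noteq> {}" using n_pos by simp
  show "(\<Sum>i=1..n. real_of_int \<lfloor>v i\<rfloor>) \<le> (\<Sum>i=1..n. v i)" by (intro sum_mono) simp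
  show "(\<Sum>i=1..n. v i) \<le> (\<Sum>i=1..n. real_of_int \<lceil>v i\<rceil>)" by (intro sum_mono) simp
  have "v i < of_int \<lfloor>v i\<rfloor> + 1" "of_int \<lceil>v i\<rceil> < v i + 1" for i by linarith+
  then have "(\<Sum>i=1..n. v i) < (\<Sum>i=1..n. of_int \<lfloor>v i\<rfloor> + 1)"
    "(\<Sum>i=1..n. of_int \<lceil>v i\<rceil>) < (\<Sum>i=1..n. v i + 1)"
    using n by (intro sum_strict_mono; simp)+
  then show "(\<Sum>i=1..n. v i) < (\<Sum>i=1..n. real_of_int \<lfloor>v i\<rfloor>) + real n"
    "(\<Sum>i=1..n. real_of_int \<lceil>v i\<rceil>) < (\<Sum>i=1..n. v i) + real n"
    by (simp_all add: sum.distrib)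
qed

lemma sum_x: "(\<Sum>i=1..n. x i) = max (R - n) (\<Sum>i=1..n. of_int (l i))"
  and sum_y: "(\<Sum>i=1..n. y i) = min (R + n) (\<Sum>i=1..n. of_int (u i))"
  using lower_sum upper_sum by (simp_all add: x_def y_def)

text \<open>\<open>k\<close> counts the unit steps still to be taken above \<open>lo\<close>. The
  strict lower bound on \<open>R\<close> makes it positive, so \<open>k - 1\<close> is the position
  of the \<open>k\<close>-th cheapest step.\<close>

lemma k: "real k = R - (\<Sum>i=1..n. lo i)" "0 < k"
proof -
  have "(\<Sum>i=1..n. of_int (lo i)) < R"
    using sum_floor_bounds(1)[of x] sum_x R_bounds n_pos unfolding lo_def by linarith
  with R_int show "real k = R - (\<Sum>i=1..n. lo i)" "0 < k"
    by (auto simp: k_def elim!: Ints_cases simp flip: of_int_sum)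
qed

lemma length_steps: "real (\<Sum>i=1..n. length (steps i)) = (\<Sum>i=1..n. of_int (hi i)) - (\<Sum>i=1..n. of_int (lo i))"
proof -
  have "real (\<Sum>i=1..n. length (steps i)) = (\<Sum>i=1..n. of_int (hi i - lo i))"
    unfolding steps_def length_map length_upt diff_zero
    by (rule of_int_sum_nat) (use range(6) in auto)
  then show ?thesis by (simp add: sum_subtractf)
qed

lemma k_le: "k \<le> (\<Sum>i=1..n. length (steps i))"
proof -
  have "R \<le> (\<Sum>i=1..n. of_int (hi i))"
    using sum_floor_bounds(3)[of y] sum_y R_bounds by (simp add: hi_def)
  then have "real k \<le> real (\<Sum>i=1..n. length (steps i))" by (simp only: k length_steps) simp
  then show ?thesis by (simp only: of_nat_le_iff)
qed

text \<open>Both target sums are within \<open>n\<close> of \<open>R\<close> on their outer sides,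
  and rounding outwards adds less than \<open>n\<close> to each.\<close>

lemma number_of_steps: "(\<Sum>i=1..n. length (steps i)) \<le> 4 * n"
proof -
  have "(\<Sum>i=1..n. of_int (hi i)) \<le> R + n + n"
    using sum_floor_bounds(4)[of y] sum_y unfolding hi_def by linarith
  moreover have "R - n - n \<le> (\<Sum>i=1..n. of_int (lo i))"
    using sum_floor_bounds(2)[of x] sum_x unfolding lo_def by linarith
  ultimately have "real (\<Sum>i=1..n. length (steps i)) \<le> real (4 * n)"
    unfolding length_steps by simp
  then show ?thesis by (simp only: of_nat_le_iff)
qed

text \<open>Successive steps of one variable occupy adjacent intervals, which convexity
  orders.\<close>

lemma sorted_steps:
  assumes "i \<in> {1..n}"
  shows "sorted (steps i)"
  unfolding sorted_iff_nth_mono_less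
proof (intro allI impI)
  fix r s assume "r < s" "s < length (steps i)"
  then have "(real_of_int (lo i) + real r + 1) / a i + b i \<le> (real_of_int (lo i) + real s) / a i + b i"
    using pos[OF assms] by (simp add: divide_right_mono)
  from slope_le[OF convex pos[OF assms] pos[OF assms] this] \<open>r < s\<close> \<open>s < length (steps i)\<close>
  show "steps i ! r \<le> steps i ! s" by (simp add: steps_def)
qed

lemma length_filter_concat: "length (filter P (concat (map steps [1..<Suc n]))) =
    (\<Sum>i=1..n. length (filter P (steps i)))"
  by (simp add: filter_concat length_concat comp_def interv_sum_list_conv_sum_set_nat
      atLeastLessThanSuc_atLeastAtMost del: upt_Suc)

text \<open>Such a step starts at or after \<open>t'\<close>, so it costs at least as much as any
  step ending by \<open>t'\<close>. Among the candidates, variable \<open>m\<close> has at least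
  \<open>\<lfloor>y m\<rfloor> - lo m\<close> of the latter, altogether at least \<open>k\<close>;
  the \<open>k\<close>-th cheapest candidate is thus no more expensive.\<close>

lemma steps_above:
  assumes i: "i \<in> {1..n}" and j: "hi i \<le> j" "j + 1 \<le> u i" and q: "q = sort (concat (map steps [1..<Suc n])) ! (k - 1)"
  shows "q \<le> slope f (a i) (b i) (of_int j)"
proof -
  let ?\<sigma> = "slope f (a i) (b i) (of_int j)"
  have yi: "y i \<le> j" "y i < u i"
    using j le_of_int_ceiling[of "y i"] unfolding hi_def by linarith+
  then have "a i * (t' - b i) \<le> j"
    using clip_less_upper[of "l i" "u i" "a i * (t' - b i)"] box[OF i] by (simp add: y_def)
  then have right: "t' \<le> j / a i + b i" using pos[OF i] by (simp add: field_simps)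
  have "nat (\<lfloor>y m\<rfloor> - lo m) \<le> length (filter (\<lambda>s. s \<le> ?\<sigma>) (steps m))" if m: "m \<in> {1..n}" for m
  proof -
    have hi: "\<lfloor>y m\<rfloor> \<le> hi m" unfolding hi_def by linarith
    have "steps m ! r \<le> ?\<sigma>" if r: "r < nat (\<lfloor>y m\<rfloor> - lo m)" for r
    proof -
      have "of_int (lo m) + real r + 1 \<le> of_int \<lfloor>y m\<rfloor>" using r by linarith
      then have ym: "of_int (lo m) + real r + 1 \<le> y m" by linarith
      \<comment> \<open>The lower bound did not raise \<open>y m\<close>, so \<open>y m\<close> is
        at most the unclipped value, and the step does end by \<open>t'\<close>.\<close>
      then have "l m < y m" using range(5)[OF m] by linarith
      then have "y m \<le> a m * (t' - b m)"
        using clip_greater_lower[of "l m" "u m"] box[OF m] by (simp add: y_def)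
      with ym have "(of_int (lo m) + real r + 1) / a m + b m \<le> t'"
        using pos[OF m] by (simp add: field_simps)
      with right have "slope f (a m) (b m) (of_int (lo m) + real r) \<le> ?\<sigma>"
        by (intro slope_le convex pos i m) linarith
      moreover have "r < nat (hi m - lo m)" using r hi by linarith
      ultimately show ?thesis by (simp add: steps_def)
    qed
    then have "{..<nat (\<lfloor>y m\<rfloor> - lo m)} \<subseteq> {r. r < length (steps m) \<and> steps m ! r \<le> ?\<sigma>}"
      using hi by (auto simp: steps_def)
    from card_mono[OF _ this] show ?thesis by (simp add: length_filter_conv_card)
  qed
  moreover have "real_of_int d \<le> real c" if "nat d \<le> c" for d c using that by linarith
  ultimately have "(\<Sum>m=1..n. of_int (\<lfloor>y m\<rfloor> - lo m)) \<le> (\<Sum>m=1..n. real (length (filter (\<lambda>s. s \<le> ?\<sigma>) (steps m))))"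
    by (intro sum_mono) blast
  moreover have "real k \<le> (\<Sum>m=1..n. of_int (\<lfloor>y m\<rfloor> - lo m))"
  proof -
    \<comment> \<open>The free room of variable \<open>i\<close> rules out truncation of the target,
      so the full shift by \<open>n\<close> is available.\<close>
    have "(\<Sum>m=1..n. y m) < (\<Sum>m=1..n. of_int (u m))"
      using i yi(2) range(2) by (intro sum_strict_mono_ex1) auto
    then have "(\<Sum>m=1..n. y m) = R + n" using sum_y by linarith
    then show ?thesis
      using sum_floor_bounds(2)[of y] by (simp add: k sum_subtractf)
  qed
  ultimately have "k \<le> length (filter (\<lambda>s. s \<le> ?\<sigma>) (concat (map steps [1..<Suc n])))"
    unfolding length_filter_concat by (simp flip: of_nat_sum)
  with k(2) show ?thesis unfolding q by (intro nth_sort_le) linarith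
qed

text \<open>Mirror image: the step ends by \<open>t\<close>, whereas the steps of \<open>m\<close>
  from \<open>\<lceil>x m\<rceil>\<close> on start at or after \<open>t\<close> and are not cheaper.
  Fewer than \<open>k\<close> candidates are strictly cheaper, by the strict bound on the sum of the
  ceilings, so the one at position \<open>k - 1\<close> is not among them.\<close>

lemma steps_below:
  assumes i: "i \<in> {1..n}" and j: "l i \<le> j" "j < lo i" and q: "q = sort (concat (map steps [1..<Suc n])) ! (k - 1)"
  shows "slope f (a i) (b i) (of_int j) \<le> q"
proof -
  let ?\<sigma> = "slope f (a i) (b i) (of_int j)"
  have xi: "of_int j + 1 \<le> x i" "l i < x i"
    using j of_int_floor_le[of "x i"] unfolding lo_def by linarith+
  then have "of_int j + 1 \<le> a i * (t - b i)"
    using clip_greater_lower[of "l i" "u i" "a i * (t - b i)"] box[OF i] by (simp add: x_def)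
  then have left: "(of_int j + 1) / a i + b i \<le> t" using pos[OF i] by (simp add: field_simps)
  have "length (filter (\<lambda>s. s < ?\<sigma>) (steps m)) \<le> nat (\<lceil>x m\<rceil> - lo m)" if m: "m \<in> {1..n}" for m
  proof -
    have "r < nat (\<lceil>x m\<rceil> - lo m)" if r: "r < length (steps m)" "steps m ! r < ?\<sigma>" for r
    proof (rule ccontr)
      assume "\<not> r < nat (\<lceil>x m\<rceil> - lo m)"
      then have "of_int \<lceil>x m\<rceil> \<le> of_int (lo m) + real r" by linarith
      then have xm: "x m \<le> of_int (lo m) + real r" using le_of_int_ceiling[of "x m"] by linarith
      have "of_int (lo m) + real r < of_int (hi m)" using r(1) by (simp add: steps_def)
      then have "x m < u m" using xm range(7)[OF m] by linarith
      then have "a m * (t - b m) \<le> x m"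
        using clip_less_upper[of "l m" "u m"] box[OF m] by (simp add: x_def)
      with xm have "t \<le> (of_int (lo m) + real r) / a m + b m"
        using pos[OF m] by (simp add: field_simps)
      with left have "?\<sigma> \<le> slope f (a m) (b m) (of_int (lo m) + real r)"
        by (intro slope_le convex pos i m) linarith
      then show False using r by (simp add: steps_def)
    qed
    then have "{r. r < length (steps m) \<and> steps m ! r < ?\<sigma>} \<subseteq> {..<nat (\<lceil>x m\<rceil> - lo m)}" by auto
    from card_mono[OF _ this] show ?thesis by (simp add: length_filter_conv_card)
  qed
  moreover have "real c \<le> real_of_int (\<lceil>x m\<rceil> - lo m)" if "c \<le> nat (\<lceil>x m\<rceil> - lo m)" for c m
    using that unfolding lo_def by linarith
  ultimately have "(\<Sum>m=1..n. real (length (filter (\<lambda>s. s < ?\<sigma>) (steps m)))) \<le> (\<Sum>m=1..n. of_int (\<lceil>x m\<rceil> - lo m))"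
    by (intro sum_mono) blast
  moreover have "(\<Sum>m=1..n. of_int (\<lceil>x m\<rceil> - lo m)) < real k"
  proof -
    have "(\<Sum>m=1..n. of_int (l m)) < (\<Sum>m=1..n. x m)"
      using i xi(2) range(1) by (intro sum_strict_mono_ex1) auto
    then have "(\<Sum>m=1..n. x m) = R - n" using sum_x by linarith
    then show ?thesis
      using sum_floor_bounds(4)[of x] by (simp add: k sum_subtractf)
  qed
  ultimately have "length (filter (\<lambda>s. s < ?\<sigma>) (concat (map steps [1..<Suc n]))) < k"
    unfolding length_filter_concat by (simp flip: of_nat_sum)
  moreover have "k \<le> length (concat (map steps [1..<Suc n]))"
    using k_le length_filter_concat[of "\<lambda>_. True"] by simp
  ultimately show ?thesis using k(2) unfolding q by (intro nth_sort_ge) linarith+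
qed

text \<open>\<open>q\<close> is the threshold. Steps of a variable below \<open>lo\<close> and from
  \<open>hi\<close> on are settled by counting across all variables; between them the sorted list
  \<open>steps i\<close> and the bounds on \<open>c i\<close> suffice.\<close>

lemma optimal_fill:
  fixes c :: "nat \<Rightarrow> nat"
  assumes q: "q = sort (concat (map steps [1..<Suc n])) ! (k - 1)"
    and c: "\<And>i. i \<in> {1..n} \<Longrightarrow> length (filter (\<lambda>s. s < q) (steps i)) \<le> c i"
      "\<And>i. i \<in> {1..n} \<Longrightarrow> c i \<le> length (filter (\<lambda>s. s \<le> q) (steps i))"
    and sum: "(\<Sum>i=1..n. c i) = k"
  shows "optimal Intg n a b f R (\<lambda>i. of_int (l i)) (\<lambda>i. of_int (u i)) (\<lambda>i. of_int (lo i) + real (c i))"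
proof -
  let ?z = "\<lambda>i. lo i + int (c i)"
  have len: "length (steps i) = nat (hi i - lo i)" for i by (simp add: steps_def)
  have c_le: "int (c i) \<le> hi i - lo i" if "i \<in> {1..n}" for i
    using c(2)[OF that] length_filter_le[of "\<lambda>s. s \<le> q" "steps i"] range(6)[OF that] unfolding len
    by linarith
  have nth: "steps i ! nat (j - lo i) = slope f (a i) (b i) j" if "lo i \<le> j" "j < hi i" for i j
    using that by (simp add: steps_def)
  have "optimal Intg n a b f R (\<lambda>i. of_int (l i)) (\<lambda>i. of_int (u i)) (\<lambda>i. of_int (?z i))"
  proof (rule optimal_integer_threshold[where q = q])
    have "(\<Sum>i=1..n. real_of_int (?z i)) = (\<Sum>i=1..n. of_int (lo i)) + real (\<Sum>i=1..n. c i)"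
      by (simp add: sum.distrib)
    also have "\<dots> = R" unfolding sum using k(1) by simp
    finally show "feasible Intg n R (\<lambda>i. of_int (l i)) (\<lambda>i. of_int (u i)) (\<lambda>i. of_int (?z i))"
      using range(5,7) c_le by (force simp: feasible_def simp del: of_int_add)
  next
    fix i j assume i: "i \<in> {1..n}" and j: "?z i \<le> j" "real_of_int (j + 1) \<le> real_of_int (u i)"
    show "q \<le> slope f (a i) (b i) (of_int j)"
    proof (cases "hi i \<le> j")
      case True
      with steps_above[OF i True _ q] j show ?thesis by linarith
    next
      case False
      with j have "nat (j - lo i) < length (steps i)" "c i \<le> nat (j - lo i)" unfolding len by linarith+
      from sorted_nth_threshold(2)[OF sorted_steps[OF i] this(1) c(1)[OF i] this(2)]
      show ?thesis using nth[of i j] j False by simp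
    qed
  next
    fix i j assume i: "i \<in> {1..n}" and j: "real_of_int (l i) \<le> real_of_int j" "j < ?z i"
    show "slope f (a i) (b i) (of_int j) \<le> q"
    proof (cases "j < lo i")
      case True
      with steps_below[OF i _ True q] j show ?thesis by simp
    next
      case False
      with j c_le[OF i] have "nat (j - lo i) < length (steps i)" "nat (j - lo i) < c i" unfolding len by linarith+
      from sorted_nth_threshold(1)[OF sorted_steps[OF i] this c(2)[OF i]]
      show ?thesis using nth[of i j] j False c_le[OF i] by simp
    qed
  qed
  then show ?thesis by simp
qed

end


section \<open>Correctness and running time\<close>

lemma sum_list_upt: "(\<Sum>i\<leftarrow>[1..<Suc n]. g i) = (\<Sum>i=1..n. g i)"
  by (simp add: interv_sum_list_conv_sum_set_nat atLeastLessThanSuc_atLeastAtMost del: upt_Suc)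

text \<open>On \<open>{1..n}\<close> the lower bounds are then the only feasible values. This
  settles integer instances with no step to distribute, among them \<open>n = 0\<close>.\<close>

lemma optimal_lowest:
  assumes "\<And>i. i \<in> {1..n} \<Longrightarrow> l i \<le> u i" "\<gamma> = Intg \<Longrightarrow> \<forall>i\<in>{1..n}. l i \<in> \<int>" "(\<Sum>i=1..n. l i) = R"
  shows "optimal \<gamma> n a b f R l u l"
  unfolding optimal_def
proof (intro conjI allI impI)
  show "feasible \<gamma> n R l u l" using assms by (auto simp: feasible_def)
  fix y assume y: "feasible \<gamma> n R l u y"
  have "l i = y i" if "i \<in> {1..n}" for i
    by (rule sum_mono_inv[where I = "{1..n}"]) (use y assms(3) that in \<open>auto simp: feasible_def\<close>)
  then have "objective n a b f l = objective n a b f y"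
    unfolding objective_def by (intro sum.cong) auto
  then show "objective n a b f l \<le> objective n a b f y" by simp
qed

context machine
begin

lemma continuous_main_correct:
  assumes "convex_on UNIV f" "\<forall>i\<in>{1..n}. 0 < a i" "\<forall>i\<in>{1..n}. l i \<le> u i"
    and "feasible Cont n R l u y"
  shows "\<exists>x. optimal Cont n a b f R l u x \<and>
    wp rnd f prog [VNum R, vec n a, vec n b, vec n l, vec n u] continuous_main
      (\<lambda>t v. t \<le> 23000 * n + 200 \<and> v = vec n x)"
proof -
  define "is" where "is = [1..<Suc n]"
  have is_props: "set is = {1..n}" "length is = n"
    by (auto simp: is_def simp del: upt_Suc)
  have sum: "(\<Sum>i\<leftarrow>is. g i) = (\<Sum>i=1..n. g i)" for g :: "nat \<Rightarrow> real"
    unfolding is_def by (rule sum_list_upt)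
  have "(\<Sum>i=1..n. l i) \<le> R" "R \<le> (\<Sum>i=1..n. u i)"
    using assms(4) by (auto simp: feasible_def intro!: sum_mono)
  then obtain t where t: "(\<Sum>i\<leftarrow>is. clip (l i) (u i) (a i * (t - b i))) = R"
    and relax: "computes 1 [VNum R, encode (map a is), encode (map b is), encode (map l is), encode (map u is)]
      (23000 * length is + 100) (encode (map (\<lambda>i. clip (l i) (u i) (a i * (t - b i))) is))"
    using computes_relax[of "is" a l u R b] assms(2,3) by (auto simp: is_props sum)
  have "wp rnd f prog [VNum R, vec n a, vec n b, vec n l, vec n u] continuous_main
      (\<lambda>t' v. t' \<le> 23000 * n + 200 \<and> v = vec n (\<lambda>i. clip (l i) (u i) (a i * (t - b i))))"
    unfolding vec_def is_def[symmetric]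
    by (rule computesE[OF relax]) (simp add: continuous_main_def wp_simps is_props)
  with optimal_continuous[OF assms(1-3), where b = b and t = t and R = R] t show ?thesis unfolding sum by blast
qed

text \<open>Two relaxations cost \<open>46000 * n\<close> and the selection among at most
  \<open>4 * n\<close> steps \<open>20000 * n\<close>; the linear passes fit into the
  remainder.\<close>

lemma integer_main_correct:
  assumes rnd and convex: "convex_on UNIV f" and pos: "\<forall>i\<in>{1..n}. 0 < a i"
    and feas: "feasible Intg n R l u y"
  shows "\<exists>x. optimal Intg n a b f R l u x \<and>
    wp rnd f prog [VNum R, vec n a, vec n b, vec n l, vec n u] integer_main
      (\<lambda>t v. t \<le> 80000 * n + 1000 \<and> v = vec n x)"
proof -
  define "is" where "is = [1..<Suc n]"
  have is_props: "set is = {1..n}" "length is = n" "distinct is"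
    by (auto simp: is_def simp del: upt_Suc)
  have sum: "(\<Sum>i\<leftarrow>is. g i) = (\<Sum>i=1..n. g i)" for g :: "nat \<Rightarrow> 'b :: comm_monoid_add"
    unfolding is_def by (rule sum_list_upt)
  define l' where "l' = (\<lambda>i. real_of_int \<lceil>l i\<rceil>)"
  define u' where "u' = (\<lambda>i. real_of_int \<lfloor>u i\<rfloor>)"
  define L where "L = (\<Sum>i\<leftarrow>is. l' i)"
  define U where "U = (\<Sum>i\<leftarrow>is. u' i)"
  have feas': "feasible Intg n R l' u' y"
    using feas unfolding l'_def u'_def feasible_round .
  then have box: "l' i \<le> u' i" if "i \<in> {1..n}" for i
    using that by (force simp: feasible_def)
  have bounds: "L \<le> R" "R \<le> U"
    using feas' by (auto simp: L_def U_def sum feasible_def intro!: sum_mono)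
  have "R \<in> \<int>" using feas by (auto simp: feasible_def)
  note calls = computes_ceilings[OF \<open>rnd\<close>, of l "is", folded l'_def]
    computes_floors[OF \<open>rnd\<close>, of u "is", folded u'_def]
    computes_sum[of "map l' is", folded L_def]
  show ?thesis
  proof (cases "R \<le> L")
    case True
    have "optimal Intg n a b f R l' u' l'"
      using box bounds True by (intro optimal_lowest) (auto simp: l'_def L_def sum)
    then have "optimal Intg n a b f R l u l'"
      unfolding l'_def u'_def optimal_round .
    moreover have "wp rnd f prog [VNum R, vec n a, vec n b, vec n l, vec n u] integer_main
      (\<lambda>t v. t \<le> 80000 * n + 1000 \<and> v = vec n l')"
      unfolding vec_def is_def[symmetric]
      by (rule computesE[OF calls(1)], rule computesE[OF calls(2)], rule computesE[OF calls(3)])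
        (use True in \<open>simp add: integer_main_def wp_simps is_props\<close>)
    ultimately show ?thesis by blast
  next
    case False
    define r1 where "r1 = max (R - n) L"
    define r2 where "r2 = min (R + n) U"
    have r1: "r1 = (if R - n \<le> L then L else R - n)" and r2: "r2 = (if R + n \<le> U then R + n else U)"
      by (auto simp: r1_def r2_def)
    have boxes: "\<forall>i\<in>set is. 0 < a i \<and> l' i \<le> u' i" using pos box by (simp add: is_props)
    obtain t where t: "(\<Sum>i\<leftarrow>is. clip (l' i) (u' i) (a i * (t - b i))) = r1"
      and relax1: "computes 1 [VNum r1, encode (map a is), encode (map b is), encode (map l' is), encode (map u' is)]
        (23000 * length is + 100) (encode (map (\<lambda>i. clip (l' i) (u' i) (a i * (t - b i))) is))"
      using computes_relax[OF boxes, of r1 b] bounds by (force simp: r1_def L_def U_def)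
    obtain t' where t': "(\<Sum>i\<leftarrow>is. clip (l' i) (u' i) (a i * (t' - b i))) = r2"
      and relax2: "computes 1 [VNum r2, encode (map a is), encode (map b is), encode (map l' is), encode (map u' is)]
        (23000 * length is + 100) (encode (map (\<lambda>i. clip (l' i) (u' i) (a i * (t' - b i))) is))"
      using computes_relax[OF boxes, of r2 b] bounds by (force simp: r2_def L_def U_def)
    interpret rounding f n a b "\<lambda>i. \<lceil>l i\<rceil>" "\<lambda>i. \<lfloor>u i\<rfloor>" R t t'
    proof
      show "\<lceil>l i\<rceil> \<le> \<lfloor>u i\<rfloor>" if "i \<in> {1..n}" for i
        using box[OF that] by (simp add: l'_def u'_def)
    qed (use convex pos \<open>R \<in> \<int>\<close> False bounds t t' in
        \<open>simp_all add: l'_def u'_def L_def U_def r1_def r2_def sum\<close>)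
    define lo' where "lo' = (\<lambda>i. real_of_int (lo i))"
    define hi' where "hi' = (\<lambda>i. real_of_int (hi i))"
    define S where "S = (\<Sum>i\<leftarrow>is. lo' i)"
    have lo': "(\<lambda>i. real_of_int \<lfloor>clip (l' i) (u' i) (a i * (t - b i))\<rfloor>) = lo'"
      and hi': "(\<lambda>i. real_of_int \<lceil>clip (l' i) (u' i) (a i * (t' - b i))\<rceil>) = hi'"
      by (auto simp: lo'_def hi'_def lo_def hi_def x_def y_def l'_def u'_def)
    define all where "all = concat (map steps is)"
    define q where "q = sort all ! (k - 1)"
    have len_all: "length all = (\<Sum>i=1..n. length (steps i))"
      unfolding all_def length_concat map_map comp_def sum ..
    have k_all: "k - 1 < length all" using k(2) k_le by (simp add: len_all)
    let ?k = "\<lambda>s. s :: real" and ?g = "\<lambda>_ :: real. VNil"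
    let ?lt = "\<lambda>i. length (filter (\<lambda>s. s < q) (steps i))"
    let ?eq = "\<lambda>i. length (filter (\<lambda>s. s = q) (steps i))"
    define \<rho> where "\<rho> = k - length (filter (\<lambda>s. s < q) all)"
    have filter_all: "length (filter P all) = (\<Sum>i=1..n. length (filter P (steps i)))" for P
      unfolding all_def is_def by (rule length_filter_concat)
    \<comment> \<open>Since \<open>q\<close> has position \<open>k - 1\<close> in sorted order,
      fewer than \<open>k\<close> steps are cheaper and at least \<open>k\<close> cost at most
      \<open>q\<close>. Hence the subtraction in \<rho> is exact and the ties suffice for the
      quota.\<close>
    have "k - 1 < length (filter (\<lambda>s. s \<le> q) all)" "length all - (k - 1) \<le> length (filter (\<lambda>s. q \<le> s) all)"
      using length_filter_nth_sort[OF k_all, of ?k] by (simp_all add: q_def)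
    moreover note length_filter_trichotomy(1,3)[of ?k q all] length_filter_trichotomy(2)[of q ?k all]
    ultimately have counts: "length (filter (\<lambda>s. s < q) all) \<le> k"
      "k \<le> length (filter (\<lambda>s. s < q) all) + length (filter (\<lambda>s. s = q) all)"
      using k_all k(2) by linarith+
    have R_eq: "real k = R - S" unfolding k(1) S_def lo'_def sum by simp
    have k_eq: "real (k - 1) = R - S - 1" "real \<rho> = R - S - real (length (filter (\<lambda>s. s < q) all))"
      using k(2) counts(1) R_eq by (simp_all add: \<rho>_def of_nat_diff)
    have "concat (map (\<lambda>i. map (\<lambda>s. VCons (VNum s) VNil) (steps i)) is) = map (\<lambda>s. VCons (VNum s) VNil) all"
      by (simp add: all_def map_concat comp_def)
    with computes_concat[of "map (\<lambda>i. map (\<lambda>s. VCons (VNum s) VNil) (steps i)) is"]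
    have conc: "computes 21 [lst (map (\<lambda>i. keyed ?k ?g (steps i)) is)]
        (15 * length all + 15 * length is + 3) (keyed ?k ?g all)"
      by (simp add: comp_def)
    have select: "computes 9 [keyed ?k ?g all, VNum (R - S - 1)] (5000 * length all) (VNum q)"
      using computes_select[OF k_all, of ?k ?g] by (simp add: k_eq(1) q_def del: One_nat_def)
    have len: "computes 15 [encode (map a is)] (7 * length is + 3) (VNum (length is))"
      using computes_len[of "map VNum (map a is)"] by (simp add: encode_lst)
    note floors = computes_floors[OF \<open>rnd\<close>, of "\<lambda>i. clip (l' i) (u' i) (a i * (t - b i))" "is", unfolded lo']
      and ceilings = computes_ceilings[OF \<open>rnd\<close>, of "\<lambda>i. clip (l' i) (u' i) (a i * (t' - b i))" "is", unfolded hi']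
    have "\<forall>i\<in>set is. a i \<noteq> 0" using boxes by auto
    moreover have "\<forall>i\<in>set is. hi' i = lo' i + real (nat (hi i - lo i))"
      using range(6) by (auto simp: is_props hi'_def lo'_def)
    ultimately have "computes 19 [encode (map a is), encode (map b is), encode (map lo' is), encode (map hi' is)]
        (40 * (\<Sum>i\<leftarrow>is. nat (hi i - lo i)) + 40 * length is + 3)
        (lst (map (\<lambda>i. keyed ?k ?g (steps i)) is))"
      unfolding steps_def lo'_def by (rule computes_units)
    moreover have "(\<Sum>i\<leftarrow>is. nat (hi i - lo i)) \<le> 4 * n"
      using number_of_steps by (simp add: sum steps_def)
    ultimately have units: "computes 19 [encode (map a is), encode (map b is), encode (map lo' is), encode (map hi' is)]
        (200 * n + 3) (lst (map (\<lambda>i. keyed ?k ?g (steps i)) is))"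
      by (elim computes_mono) (simp add: is_props)
    obtain c where fill: "computes 22
        [VNum q, VNum (real \<rho>), encode (map lo' is), lst (map (\<lambda>i. keyed ?k ?g (steps i)) is)]
        (70 * (\<Sum>i\<leftarrow>is. length (steps i)) + 100 * length is + 3)
        (encode (map (\<lambda>i. lo' i + real (c i)) is))"
      and c: "\<forall>i\<in>set is. ?lt i \<le> c i \<and> c i \<le> ?lt i + ?eq i"
        "\<rho> \<le> (\<Sum>i\<leftarrow>is. ?eq i) \<longrightarrow> (\<Sum>i\<leftarrow>is. c i) = (\<Sum>i\<leftarrow>is. ?lt i) + \<rho>"
      using computes_fill[OF is_props(3), where us = steps and q = q and \<rho> = \<rho> and lo = lo'] by blast
    have size: "length all \<le> 4 * n"
      unfolding len_all by (rule number_of_steps)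
    have sizes: "length all \<le> 4 * n" "(\<Sum>i\<leftarrow>is. length (steps i)) \<le> 4 * n"
      "length (filter (\<lambda>s. s < q) all) \<le> 4 * n"
      using size le_trans[OF length_filter_le size] by (simp_all only: sum len_all)
    have "(\<Sum>i=1..n. c i) = k"
      using c(2) counts unfolding sum filter_all \<rho>_def by simp
    moreover have "?lt i \<le> c i \<and> c i \<le> ?lt i + ?eq i" if "i \<in> {1..n}" for i
      using c(1) that unfolding is_props(1) by blast
    moreover have "?lt i + ?eq i = length (filter (\<lambda>s. s \<le> q) (steps i))" for i
      using length_filter_trichotomy(2)[of q ?k "steps i"] length_filter_trichotomy(3)[of ?k q "steps i"]
      by linarith
    ultimately have "optimal Intg n a b f R l' u' (\<lambda>i. lo' i + real (c i))"
      unfolding l'_def u'_def lo'_def by (intro optimal_fill[of q]) (simp_all add: q_def all_def is_def)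
    then have "optimal Intg n a b f R l u (\<lambda>i. lo' i + real (c i))"
      unfolding l'_def u'_def optimal_round .
    moreover have "wp rnd f prog [VNum R, vec n a, vec n b, vec n l, vec n u] integer_main
      (\<lambda>t v. t \<le> 80000 * n + 1000 \<and> v = vec n (\<lambda>i. lo' i + real (c i)))"
      unfolding vec_def is_def[symmetric]
      by (rule computesE[OF calls(1)], rule computesE[OF calls(2)], rule computesE[OF calls(3)],
          rule computesE[OF len],
          rule computesE[OF computes_sum[of "map u' is", folded U_def]],
          rule computesE[OF relax1],
          rule computesE[OF floors],
          rule computesE[OF relax2],
          rule computesE[OF ceilings],
          rule computesE[OF units],
          rule computesE[OF conc],
          rule computesE[OF computes_sum[of "map lo' is", folded S_def]],
          rule computesE[OF select],
          rule computesE[OF computes_below[of q ?k ?g all]],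
          rule computesE[OF computes_len_keyed[of ?k ?g "filter (\<lambda>s. s < q) all"]],
          rule computesE[OF fill[unfolded k_eq]])
        (use False r1 r2 sizes in \<open>cases "R - real n \<le> L"; cases "R + real n \<le> U"; simp add: integer_main_def wp_simps is_props\<close>)
    ultimately show ?thesis by blast
  qed
qed

end

lemma solves_withinI:
  assumes "\<And>f n a b R l u y. convex_on UNIV f \<Longrightarrow> \<forall>i\<in>{1..n}. 0 < a i \<Longrightarrow> \<forall>i\<in>{1..n}. l i \<le> u i \<Longrightarrow>
    feasible \<gamma> n R l u y \<Longrightarrow> \<exists>x. optimal \<gamma> n a b f R l u x \<and>
      wp (\<gamma> = Intg) f (main # library) [VNum R, vec n a, vec n b, vec n l, vec n u] main
        (\<lambda>t v. t \<le> c * n + d \<and> v = vec n x)"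
  shows "solves_within (main # library) \<gamma> (\<lambda>n. real (c * n + d))"
  unfolding solves_within_def
proof (intro conjI allI impI)
  fix f :: "real \<Rightarrow> real" and n R and a b l u :: "nat \<Rightarrow> real"
  assume *: "convex_on UNIV f" "\<forall>i\<in>{1..n}. 0 < a i" "\<forall>i\<in>{1..n}. l i \<le> u i" "\<exists>y. feasible \<gamma> n R l u y"
  then obtain y where "feasible \<gamma> n R l u y" by blast
  from assms[OF *(1-3) this, of b] show "\<exists>t x. eval (\<gamma> = Intg) f (main # library)
      [VNum R, vec n a, vec n b, vec n l, vec n u] ((main # library) ! 0) t (vec n x) \<and>
      optimal \<gamma> n a b f R l u x \<and> real t \<le> real (c * n + d)"
    unfolding wp_def nth_Cons_0 of_nat_le_iff by blast
qed simp

lemma affine_in_bigo: "(\<lambda>n. real (c * n + d)) \<in> O(\<lambda>n. real n)"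
proof (rule bigoI)
  show "\<forall>\<^sub>F n in sequentially. norm (real (c * n + d)) \<le> real (c + d) * norm (real n)"
    using eventually_ge_at_top[of "1 :: nat"]
  proof eventually_elim
    case (elim n)
    then have "c * n + d \<le> (c + d) * n" by (simp add: add_mult_distrib)
    then have "real (c * n + d) \<le> real ((c + d) * n)" by (simp only: of_nat_le_iff)
    then show ?case by simp
  qed
qed

theorem corollary4:
  "(\<exists>P T. T \<in> O(\<lambda>n. real n) \<and> solves_within P Cont T) \<and>
   (\<exists>P T. T \<in> O(\<lambda>n. real n) \<and> solves_within P Intg T)"
proof (intro conjI exI)
  show "solves_within (continuous_main # library) Cont (\<lambda>n. real (23000 * n + 200))"
    by (rule solves_withinI) (rule machine.continuous_main_correct)
  show "solves_within (integer_main # library) Intg (\<lambda>n. real (80000 * n + 1000))"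
    by (rule solves_withinI) (rule machine.integer_main_correct, simp_all)
qed (rule affine_in_bigo)+

end
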